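(* Let $n_T,n_R\ge 1$ and consider the point-to-point flat fading $n_T\times n_R$ MIMO channel described in the context, with any coding rate $0<R_c<1$. Suppose the $n_T\times n_T$ precoders $P_t$, $t=1,2,\dots$, are randomly generated for each channel use (independently of each other and of $H$), each being uniformly distributed in the set $\mathcal{M}(n_T,n_T)$ of all $n_T\times n_T$ unitary matrices. Then full diversity is achieved in terms of the outage probability, i.e. $$d_{\mathrm{out}}=\lim_{\gamma\to\infty}-\frac{\log P_{\mathrm{out}}(\gamma)}{\log\gamma}=n_T n_R .$$
   Context: Channel: $H\in\mathbb{C}^{n_R\times n_T}$ has i.i.d. circularly symmetric complex Gaussian entries $\mathcal{CN}(0,1)$; $H$ is drawn once and stays constant for all channel uses $t=1,\dots,N_c$ of a codeword. It is known at the receiver and unknown at the transmitter; the precoders are also known at the receiver. The received vector at channel use $t$ is $$\tilde{\mathbf y}_t=\sqrt{\gamma}\,H\tilde{\mathbf x}_t+\tilde{\mathbf w}_t,\qquad \tilde{\mathbf x}_t=P_t\mathbf z_t,$$ where $\gamma>0$ is the SNR, $\tilde{\mathbf w}_t\in\mathbb{C}^{n_R}$ has i.i.d. $\mathcal{CN}(0,1)$ entries, and $P_t$ is an $n_T\times n_T$ unitary matrix (the precoder). Input: $M=2^q$ with $q\ge1$ a fixed integer (not depending on $\gamma$). The vector $\mathbf z_t\in\mathbb{C}^{n_T}$ has its first $\min(n_T,n_R)$ components independent and uniformly distributed on an $M$-QAM constellation (a fixed set of $M$ distinct complex points), and its last $n_T-\min(n_T,n_R)$ components equal to zero. The constellation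 is scaled so that its mean square magnitude is $1$ if $n_R\ge n_T$ and $n_T/n_R$ if $n_R<n_T$, so that $\mathbb{E}\|\tilde{\mathbf x}_t\|^2=n_T$. Put $m=\min(n_T,n_R)\log_2 M$ (coded bits per channel use) and $R=mR_c$ (spectral efficiency), where $R_c$ is the coding rate. Let $I(\tilde{\mathbf x}_t;\tilde{\mathbf y}_t\mid H)$ denote the mutual information in bits between input and output at channel use $t$ for the given realizations of $H$ and $P_t$, when $\tilde{\mathbf x}_t=P_t\mathbf z_t$ and the first $\min(n_T,n_R)$ components of $\mathbf z_t$ are independent and uniformly distributed on the $M$-QAM constellation, the remaining components being zero. The outage probability is $$P_{\mathrm{out}}(\gamma)=\Pr\left(\left[\lim_{N_c\to\infty}\frac1{N_c}\sum_{t=1}^{N_c} I(\tilde{\mathbf x}_t;\tilde{\mathbf y}_t\mid H)\right]<R\right).$$ The diversity order is $d_{\mathrm{out}}=\lim_{\gamma\to\infty}-\log P_{\mathrm{out}}(\gamma)/\log\gamma$. "Uniformly distributed" on the set of unitary matrices means with respect to the Haar probability measure. "Full diversity" means $d_{\mathrm{out}}=n_Tn_R$. *)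

theory Defs
  imports "HOL-Probability.Probability"
begin

definition conj_transpose :: "complex^'n^'m \<Rightarrow> complex^'m^'n" where
  "conj_transpose A = (\<chi> i j. cnj (A $ j $ i))"

definition unitary :: "complex^'n^'n \<Rightarrow> bool" where
  "unitary U \<longleftrightarrow> conj_transpose U ** U = mat 1 \<and> U ** conj_transpose U = mat 1"

text \<open>The Haar probability measure of the unitary group, seen as a Borel measure on the space of
  all square matrices. On this compact group left invariance determines it uniquely (and
  implies right invariance).\<close>

definition haar_unitary :: "(complex^'n^'n) measure \<Rightarrow> bool" where
  "haar_unitary \<mu> \<longleftrightarrow> prob_space \<mu> \<and> sets \<mu> = sets borel \<and> (AE U in \<mu>. unitary U) \<and>
     (\<forall>V. unitary V \<longrightarrow> distr \<mu> borel (\<lambda>U. V ** U) = \<mu>)"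

text \<open>$\mathcal{CN}(0,1)$: independent real and imaginary parts, each of variance $1/2$ (the
  second argument of \<^const>\<open>normal_density\<close> is the standard deviation).\<close>

definition complex_gaussian :: "complex measure" where
  "complex_gaussian =
     (let N = density lborel (\<lambda>x. ennreal (normal_density 0 (sqrt (1/2)) x))
      in distr (N \<Otimes>\<^sub>M N) borel (\<lambda>(a, b). Complex a b))"

definition noise :: "(complex^'r) measure" where
  "noise = distr (PiM UNIV (\<lambda>_. complex_gaussian)) borel vec_lambda"

definition first_indices :: "nat \<Rightarrow> 't::{finite,linorder} set" where
  "first_indices k = {i. card {..<i} < k}"

text \<open>Law of the vector whose first \<open>k\<close> components are independent and uniform on \<open>S\<close>, the
  remaining ones being zero.\<close>

definition input_pmf :: "complex set \<Rightarrow> nat \<Rightarrow> (complex^'t::{finite,linorder}) pmf" where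
  "input_pmf S k = map_pmf vec_lambda (Pi_pmf (first_indices k) 0 (\<lambda>_. pmf_of_set S))"

text \<open>Mutual information, in bits, between $\tilde x = P z$ and
  $\tilde y = \sqrt{\gamma} H \tilde x + w$ for fixed matrices \<open>H\<close> and \<open>P\<close>.\<close>

definition channel_information ::
  "complex set \<Rightarrow> real \<Rightarrow> complex^'t::{finite,linorder}^'r \<Rightarrow> complex^'t::{finite,linorder}^'t::{finite,linorder} \<Rightarrow> real" where
  "channel_information S \<gamma> H P =
     prob_space.mutual_information
       (measure_pmf (input_pmf S (min CARD('t) CARD('r))) \<Otimes>\<^sub>M noise) 2 borel borel
       (\<lambda>(z, w). P *v z)
       (\<lambda>(z, w). sqrt \<gamma> *\<^sub>R (H *v (P *v z)) + w)"

definition outage_probability ::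
  "'a measure \<Rightarrow> ('a \<Rightarrow> complex^'t::{finite,linorder}^'r) \<Rightarrow> (nat \<Rightarrow> 'a \<Rightarrow> complex^'t::{finite,linorder}^'t::{finite,linorder}) \<Rightarrow>
    complex set \<Rightarrow> real \<Rightarrow> real \<Rightarrow> real" where
  "outage_probability \<Omega> H P S R \<gamma> =
     measure \<Omega> {\<omega> \<in> space \<Omega>. \<exists>L.
       (\<lambda>N. (\<Sum>t=1..N. channel_information S \<gamma> (H \<omega>) (P t \<omega>)) / real N) \<longlonglongrightarrow> L \<and> L < R}"

end

theory Submission
  imports Defs "HOL-Real_Asymp.Real_Asymp" "HOL-Computational_Algebra.Polynomial"
begin

text \<open>For a fixed realization of \<open>H\<close>, the strong law of large numbers turns the time average of the
  mutual information into its expectation \<open>J(\<gamma>, H)\<close> over a Haar distributed precoder, so an outage is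
  the event \<open>J(\<gamma>, H) < R\<close>. Up to constants, this event says that all entries of \<open>H\<close> are at most
  \<open>1 / \<surd>\<gamma>\<close> in modulus, which has probability of order \<open>\<gamma>\<close> to the power \<open>- n\<^sub>T n\<^sub>R\<close>.
  If all entries of \<open>\<surd>\<gamma> H\<close> are small, then the output barely depends on the input, whatever the
  precoder. If one entry of \<open>\<surd>\<gamma> H\<close> is large, then a random unitary \<open>P\<close> separates the finitely many points
  \<open>\<surd>\<gamma> H P z\<close> with probability close to one, uniformly in \<open>H\<close>, and the mutual information comes close to
  its maximum, the input entropy, which exceeds \<open>R\<close> because \<open>R\<^sub>c < 1\<close>.\<close>

subsection \<open>Gaussian noise\<close>

text \<open>With one fixed precoder, a channel that nearly annihilates \<open>P (z - z')\<close> for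
  some pair of inputs may lose too much information although its entries are large. With independent
  precoders only a small fraction of the \<open>P t\<close> meets such a degeneracy. Uniformity in
  \<open>H\<close> comes from a single row: a component of \<open>H P d\<close> is the Hermitian
  product of the conjugated row with \<open>P d\<close>, and by left invariance its law depends on
  the row only through its norm. A threshold found for one unit vector therefore serves all
  channels, and a row is long as soon as one of its entries is large. On the exceptional precoders
  nothing is known about the signals, but the loss of information there is still bounded by a
  constant, because the logarithm in the information density grows at most like |w|^2. Making the
  exceptional set small against this constant brings the average up to \<open>R\<close>. As to the
  exponent, a complex entry of modulus at most const / sqrt gamma has probability of order 1 /
  gamma, and all constants vanish in the quotient of logarithms.\<close>

definition tilt :: "'a::real_normed_vector \<Rightarrow> 'a \<Rightarrow> real" where
  "tilt a w = exp ((norm w)\<^sup>2 - (norm (w - a))\<^sup>2)"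

lemma tilt_pos: "0 < tilt a w"
  by (simp add: tilt_def)

lemma borel_measurable_tilt [measurable]:
  "(\<lambda>x. tilt (f x) (g x)) \<in> borel_measurable M"
  if [measurable]: "f \<in> borel_measurable M" "g \<in> borel_measurable M"
  for f g :: "'b \<Rightarrow> 'a::{second_countable_topology, real_normed_vector}"
  unfolding tilt_def by measurable

definition real_gaussian :: "real measure" where
  "real_gaussian = density lborel (\<lambda>x. ennreal (normal_density 0 (sqrt (1/2)) x))"

lemma sets_real_gaussian [simp, measurable_cong]: "sets real_gaussian = sets borel"
  by (simp add: real_gaussian_def)

lemma prob_space_real_gaussian: "prob_space real_gaussian"
  unfolding real_gaussian_def by (rule prob_space_normal_density) simp

text \<open>With variance 1/2 the density is proportional to exp (- x^2), so the ratio of the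
  shifted to the original density is \<open>tilt a x\<close> without further constants. A density
  relative to the Gaussian itself, rather than to Lebesgue measure, survives products and images and
  so passes to the noise vector.\<close>

lemma real_gaussian_translate:
  "distr real_gaussian borel (\<lambda>x. x + a) = density real_gaussian (\<lambda>x. ennreal (tilt a x))"
proof (rule measure_eqI)
  fix A assume "A \<in> sets (distr real_gaussian borel (\<lambda>x. x + a))"
  then have A [measurable]: "A \<in> sets borel" by simp
  let ?n = "normal_density 0 (sqrt (1/2))"
  have tilt: "?n (x - a) = ?n x * tilt a x" for x
    by (simp add: normal_density_def tilt_def exp_add [symmetric] power2_eq_square algebra_simps)
  have "emeasure (distr real_gaussian borel (\<lambda>x. x + a)) A =
      (\<integral>\<^sup>+x. indicator A x \<partial>distr real_gaussian borel (\<lambda>x. x + a))"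
    by simp
  also have "\<dots> = (\<integral>\<^sup>+x. indicator A (x + a) \<partial>real_gaussian)"
    by (rule nn_integral_distr) measurable
  also have "\<dots> = (\<integral>\<^sup>+x. ennreal (?n x) * indicator A (x + a) \<partial>lborel)"
    unfolding real_gaussian_def by (subst nn_integral_density) auto
  also have "\<dots> = (\<integral>\<^sup>+x. ennreal (?n (x - a)) * indicator A x \<partial>lborel)"
    by (subst nn_integral_real_affine [where t = "- a" and c = 1]) (auto simp: add.commute)
  also have "\<dots> = (\<integral>\<^sup>+x. ennreal (?n x) * (ennreal (tilt a x) * indicator A x) \<partial>lborel)"
    by (simp add: tilt ennreal_mult mult.assoc tilt_def)
  also have "\<dots> = (\<integral>\<^sup>+x. ennreal (tilt a x) * indicator A x \<partial>real_gaussian)"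
    unfolding real_gaussian_def by (subst nn_integral_density) auto
  also have "\<dots> = emeasure (density real_gaussian (\<lambda>x. ennreal (tilt a x))) A"
    by (rule emeasure_density [symmetric]) auto
  finally show "emeasure (distr real_gaussian borel (\<lambda>x. x + a)) A =
    emeasure (density real_gaussian (\<lambda>x. ennreal (tilt a x))) A" .
qed simp

lemma borel_measurable_Complex [measurable (raw)]:
  assumes [measurable]: "f \<in> borel_measurable M" "g \<in> borel_measurable M"
  shows "(\<lambda>x. Complex (f x) (g x)) \<in> borel_measurable M"
  unfolding Complex_eq by measurable

lemma complex_gaussian_alt:
  "complex_gaussian = distr (real_gaussian \<Otimes>\<^sub>M real_gaussian) borel (\<lambda>(a, b). Complex a b)"
  by (simp add: complex_gaussian_def real_gaussian_def Let_def)

lemma sets_complex_gaussian [simp, measurable_cong]: "sets complex_gaussian = sets borel"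
  by (simp add: complex_gaussian_alt)

lemma prob_space_complex_gaussian: "prob_space complex_gaussian"
proof -
  interpret R: prob_space real_gaussian by (rule prob_space_real_gaussian)
  interpret RR: pair_prob_space real_gaussian real_gaussian ..
  show ?thesis
    unfolding complex_gaussian_alt by (rule RR.prob_space_distr) measurable
qed

lemma complex_gaussian_translate:
  "distr complex_gaussian borel (\<lambda>x. x + a) = density complex_gaussian (\<lambda>x. ennreal (tilt a x))"
proof -
  interpret R: prob_space real_gaussian by (rule prob_space_real_gaussian)
  let ?C = "\<lambda>(x, y). Complex x y" and ?N = real_gaussian
  have s: "sigma_finite_measure (distr ?N borel (\<lambda>x. x + b))" for b
    by (intro prob_space_imp_sigma_finite R.prob_space_distr) measurable
  have tilt: "tilt (Re a) (Re z) * tilt (Im a) (Im z) = tilt a z" for z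
    by (simp add: tilt_def exp_add [symmetric] cmod_power2)
  have "distr complex_gaussian borel (\<lambda>x. x + a) =
      distr (?N \<Otimes>\<^sub>M ?N) borel (\<lambda>(x, y). Complex (x + Re a) (y + Im a))"
    unfolding complex_gaussian_alt
    by (subst distr_distr) (auto simp: comp_def case_prod_unfold complex_eq_iff intro!: distr_cong)
  also have "\<dots> = distr (distr (?N \<Otimes>\<^sub>M ?N) (borel \<Otimes>\<^sub>M borel) (\<lambda>(x, y). (x + Re a, y + Im a))) borel ?C"
    by (subst distr_distr) (auto simp: comp_def case_prod_unfold)
  also have "distr (?N \<Otimes>\<^sub>M ?N) (borel \<Otimes>\<^sub>M borel) (\<lambda>(x, y). (x + Re a, y + Im a)) =
      distr ?N borel (\<lambda>x. x + Re a) \<Otimes>\<^sub>M distr ?N borel (\<lambda>y. y + Im a)"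
    by (rule pair_measure_distr [symmetric]) (auto intro: s)
  also have "\<dots> = density (?N \<Otimes>\<^sub>M ?N)
      (\<lambda>(x, y). ennreal (tilt (Re a) x) * ennreal (tilt (Im a) y))"
    using s unfolding real_gaussian_translate
    by (intro pair_measure_density) (auto intro: R.sigma_finite_measure_axioms)
  also have "\<dots> = density (?N \<Otimes>\<^sub>M ?N) (\<lambda>x. ennreal (tilt a (?C x)))"
    by (intro density_cong AE_I2)
       (auto simp: case_prod_unfold ennreal_mult [symmetric] tilt_pos less_imp_le
          tilt [of "Complex _ _", simplified])
  also have "distr \<dots> borel ?C = density complex_gaussian (\<lambda>x. ennreal (tilt a x))"
    unfolding complex_gaussian_alt by (subst density_distr) auto
  finally show ?thesis .
qed

section \<open>Gaussian vectors\<close>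

lemma borel_measurable_vec_lambda [measurable (raw)]:
  fixes f :: "'a \<Rightarrow> 'i::finite \<Rightarrow> 'b::euclidean_space"
  assumes [measurable]: "\<And>i. (\<lambda>x. f x i) \<in> borel_measurable M"
  shows "(\<lambda>x. \<chi> i. f x i) \<in> borel_measurable M"
  unfolding borel_measurable_euclidean_space [of "\<lambda>x. \<chi> i. f x i"]
proof
  fix b :: "'b ^ 'i" assume "b \<in> Basis"
  then obtain i u where b: "b = axis i u" by (auto simp: Basis_vec_def)
  show "(\<lambda>x. (\<chi> i. f x i) \<bullet> b) \<in> borel_measurable M"
    unfolding b inner_axis by simp
qed

lemma borel_measurable_vec_nth [measurable (raw)]:
  fixes f :: "'a \<Rightarrow> 'b::topological_space ^ 'i"
  assumes "f \<in> borel_measurable M"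
  shows "(\<lambda>x. f x $ i) \<in> borel_measurable M"
  by (rule measurable_compose [OF assms])
     (intro borel_measurable_continuous_onI continuous_intros)

abbreviation iid_gaussian :: "('i \<Rightarrow> complex) measure" where
  "iid_gaussian \<equiv> PiM UNIV (\<lambda>_. complex_gaussian)"

lemma measurable_vec_lambda_iid [measurable]: "vec_lambda \<in> borel_measurable iid_gaussian"
proof -
  have "(\<lambda>x. vec_lambda (\<lambda>i. x i)) \<in> borel_measurable iid_gaussian"
    by (rule borel_measurable_vec_lambda) measurable
  then show ?thesis by simp
qed

lemma sets_noise [simp, measurable_cong]: "sets noise = sets borel"
  by (simp add: noise_def)

lemma space_noise [simp]: "space noise = UNIV"
  by (simp add: noise_def)

lemma prob_space_noise: "prob_space noise"
  unfolding noise_def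
  by (intro prob_space.prob_space_distr prob_space_PiM prob_space_complex_gaussian) measurable

lemma space_complex_gaussian [simp]: "space complex_gaussian = UNIV"
  using sets_eq_imp_space_eq [OF sets_complex_gaussian] by simp

lemma measurable_shift_iid [measurable]:
  "(\<lambda>x i. x i + a i) \<in> measurable iid_gaussian iid_gaussian"
  by (intro measurable_PiM_single') auto

text \<open>Both sides are identified with the product of the shifted marginals by evaluating boxes:
  the preimage of a box under a shift is a box, and the integral of a product of one-variable
  functions factors.\<close>

lemma iid_gaussian_translate:
  fixes a :: "'i::finite \<Rightarrow> complex"
  shows "distr iid_gaussian iid_gaussian (\<lambda>x i. x i + a i) =
    density iid_gaussian (\<lambda>x. \<Prod>i\<in>UNIV. ennreal (tilt (a i) (x i)))" (is "?L = ?R")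
proof -
  interpret G: prob_space complex_gaussian by (rule prob_space_complex_gaussian)
  let ?D = "\<lambda>i. distr complex_gaussian borel (\<lambda>x. x + a i)"
  interpret P: product_sigma_finite "\<lambda>_ :: 'i. complex_gaussian"
    by (simp add: product_sigma_finite_def G.sigma_finite_measure_axioms)
  interpret D: product_sigma_finite ?D
    unfolding product_sigma_finite_def
    by (intro allI prob_space_imp_sigma_finite G.prob_space_distr) measurable
  have sets: "sets (PiM UNIV ?D) = sets (iid_gaussian :: ('i \<Rightarrow> complex) measure)"
    by (intro sets_PiM_cong) auto
  have "?L = PiM UNIV ?D"
  proof (rule D.PiM_eqI)
    fix A :: "'i \<Rightarrow> complex set" assume "\<And>i. i \<in> UNIV \<Longrightarrow> A i \<in> sets (?D i)"
    then have A [measurable]: "A i \<in> sets borel" for i by simp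
    have AP: "Pi\<^sub>E UNIV A \<in> sets iid_gaussian"
      by (intro sets_PiM_I_finite) auto
    have "?L (Pi\<^sub>E UNIV A) = iid_gaussian (Pi\<^sub>E UNIV (\<lambda>i. (\<lambda>x. x + a i) -` A i))"
      using AP by (subst emeasure_distr)
        (auto simp: PiE_UNIV_domain space_PiM intro!: arg_cong [where f = "emeasure _"])
    also have "\<dots> = (\<Prod>i\<in>UNIV. emeasure complex_gaussian ((\<lambda>x. x + a i) -` A i))"
      by (intro P.emeasure_PiM) (auto intro!: measurable_sets_borel [OF _ A])
    also have "\<dots> = (\<Prod>i\<in>UNIV. emeasure (?D i) (A i))"
      by (intro prod.cong refl) (simp add: emeasure_distr)
    finally show "?L (Pi\<^sub>E UNIV A) = (\<Prod>i\<in>UNIV. emeasure (?D i) (A i))" .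
  qed (use sets in auto)
  also have "PiM UNIV ?D = ?R"
  proof (rule D.PiM_eqI [symmetric])
    fix A :: "'i \<Rightarrow> complex set" assume "\<And>i. i \<in> UNIV \<Longrightarrow> A i \<in> sets (?D i)"
    then have A [measurable]: "A i \<in> sets borel" for i by simp
    have AP: "Pi\<^sub>E UNIV A \<in> sets iid_gaussian"
      by (intro sets_PiM_I_finite) auto
    have ind: "indicator (Pi\<^sub>E UNIV A) x = (\<Prod>i\<in>UNIV. indicator (A i) (x i) :: ennreal)" for x
      by (auto simp: indicator_def PiE_UNIV_domain Pi_iff)
    have "?R (Pi\<^sub>E UNIV A) =
        (\<integral>\<^sup>+x. (\<Prod>i\<in>UNIV. ennreal (tilt (a i) (x i)) * indicator (A i) (x i)) \<partial>iid_gaussian)"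
      using AP by (subst emeasure_density) (auto simp: ind prod.distrib)
    also have "\<dots> = (\<Prod>i\<in>UNIV. \<integral>\<^sup>+x. ennreal (tilt (a i) x) * indicator (A i) x \<partial>complex_gaussian)"
      by (rule P.product_nn_integral_prod) auto
    also have "\<dots> = (\<Prod>i\<in>UNIV. emeasure (?D i) (A i))"
      unfolding complex_gaussian_translate by (intro prod.cong refl) (simp add: emeasure_density)
    finally show "?R (Pi\<^sub>E UNIV A) = (\<Prod>i\<in>UNIV. emeasure (?D i) (A i))" .
  qed (use sets in auto)
  finally show ?thesis .
qed

lemma norm_vec_power2: "(norm x)\<^sup>2 = (\<Sum>i\<in>UNIV. (norm (x $ i))\<^sup>2)"
  by (simp add: norm_vec_def L2_set_def sum_nonneg)

text \<open>Squared norms add up over the coordinates, so the product of the coordinate tilts is the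
  tilt of the vector.\<close>

lemma noise_translate:
  "distr noise borel (\<lambda>w. w + a) = density noise (\<lambda>w. ennreal (tilt a w))"
proof -
  have tilt: "(\<Prod>i\<in>UNIV. ennreal (tilt (a $ i) (x i))) = ennreal (tilt a (vec_lambda x))" for x
    by (simp add: prod_ennreal tilt_def exp_sum [symmetric] norm_vec_power2 sum_subtractf)
  have vl: "distr (distr iid_gaussian iid_gaussian (\<lambda>x i. x i + a $ i)) borel vec_lambda =
      distr noise borel (\<lambda>w. w + a)"
    unfolding noise_def
    by (subst (1 2) distr_distr)
       (auto simp: comp_def vec_eq_iff intro!: distr_cong)
  have "distr noise borel (\<lambda>w. w + a) =
      distr (density iid_gaussian (\<lambda>x. ennreal (tilt a (vec_lambda x)))) borel vec_lambda"
    by (simp only: vl [symmetric] iid_gaussian_translate tilt)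
  also have "\<dots> = density noise (\<lambda>w. ennreal (tilt a w))"
    unfolding noise_def by (subst density_distr) auto
  finally show ?thesis .
qed

text \<open>The second moment suffices for all later integrals: the information density is bounded
  above by a constant and below by a multiple of - |w|^2.\<close>

lemma integrable_norm_noise: "integrable noise (\<lambda>w. (norm w)\<^sup>2)"
proof -
  interpret N: prob_space real_gaussian by (rule prob_space_real_gaussian)
  interpret G: prob_space complex_gaussian by (rule prob_space_complex_gaussian)
  interpret NN: pair_prob_space real_gaussian real_gaussian ..
  have 1: "integrable real_gaussian (\<lambda>x. x\<^sup>2)"
    unfolding real_gaussian_def
    by (subst integrable_real_density)
       (use integrable_normal_moment [of "sqrt (1/2)" 0 2] in auto)
  have 2: "integrable (real_gaussian \<Otimes>\<^sub>M real_gaussian) (\<lambda>p. (fst p)\<^sup>2)"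
    by (rule integrable_distr [OF measurable_fst]) (simp add: N.distr_pair_fst 1)
  from NN.integrable_product_swap [OF this]
  have "integrable (real_gaussian \<Otimes>\<^sub>M real_gaussian) (\<lambda>p. (fst p)\<^sup>2 + (snd p)\<^sup>2)"
    by (intro Bochner_Integration.integrable_add 2) (simp add: case_prod_unfold)
  then have 3: "integrable complex_gaussian (\<lambda>z. (cmod z)\<^sup>2)"
    unfolding complex_gaussian_alt
    by (subst integrable_distr_eq) (auto simp: case_prod_unfold cmod_power2)
  have 4: "integrable iid_gaussian (\<lambda>x. (cmod (x i))\<^sup>2)" for i :: 'i
  proof -
    have "distr iid_gaussian complex_gaussian (\<lambda>x. x i) = complex_gaussian"
      by (rule distr_PiM_component) (auto intro: prob_space_complex_gaussian)
    then show ?thesis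
      by (intro integrable_distr [OF measurable_component_singleton]) (simp_all add: 3)
  qed
  show ?thesis
    unfolding noise_def by (subst integrable_distr_eq) (auto simp: norm_vec_power2 intro: 4)
qed


section \<open>Small ball probabilities of Gaussian entries\<close>

lemma real_gaussian_interval:
  obtains c C where "0 < c" "0 < C"
    "\<And>e. 0 < e \<Longrightarrow> e \<le> 1 \<Longrightarrow> c * e \<le> measure real_gaussian {-e..e}"
    "\<And>e. 0 < e \<Longrightarrow> measure real_gaussian {-e..e} \<le> C * e"
proof
  let ?n = "normal_density 0 (sqrt (1/2))"
  interpret N: prob_space real_gaussian by (rule prob_space_real_gaussian)
  show "0 < 2 * ?n 1" "0 < 2 * ?n 0" by (simp_all add: normal_density_pos)
  have em: "emeasure real_gaussian {-e..e} = (\<integral>\<^sup>+x. ennreal (?n x) * indicator {-e..e} x \<partial>lborel)" for e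
    unfolding real_gaussian_def by (rule emeasure_density) auto
  have const: "(\<integral>\<^sup>+x. ennreal b * indicator {-e..e} x \<partial>lborel) = ennreal (2 * b * e)"
    if "0 \<le> b" "0 < e" for b e :: real
    using that by (simp add: nn_integral_cmult_indicator ennreal_mult [symmetric] algebra_simps)
  fix e :: real assume e: "0 < e"
  have "?n x \<le> ?n 0" for x
    by (simp add: normal_density_def divide_right_mono)
  then have "emeasure real_gaussian {-e..e} \<le> (\<integral>\<^sup>+x. ennreal (?n 0) * indicator {-e..e} x \<partial>lborel)"
    unfolding em by (intro nn_integral_mono mult_right_mono ennreal_leI) auto
  then show "measure real_gaussian {-e..e} \<le> 2 * ?n 0 * e"
    using e by (simp add: const N.emeasure_eq_measure)
  \<comment> \<open>A linear lower bound fails for large \<open>e\<close>; up to 1 the density on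
    the interval is at least its value at 1.\<close>
  assume "e \<le> 1"
  then have "?n 1 \<le> ?n x" if "\<bar>x\<bar> \<le> e" for x
    using that abs_le_square_iff [of x 1] by (simp add: normal_density_def divide_right_mono)
  then have "(\<integral>\<^sup>+x. ennreal (?n 1) * indicator {-e..e} x \<partial>lborel) \<le> emeasure real_gaussian {-e..e}"
    unfolding em by (intro nn_integral_mono) (auto simp: indicator_def intro!: ennreal_leI)
  then show "2 * ?n 1 * e \<le> measure real_gaussian {-e..e}"
    using e by (simp add: const N.emeasure_eq_measure)
qed

text \<open>The power 2 is the real dimension of the complex plane: at radius const / sqrt gamma
  each entry of \<open>H\<close> contributes one factor 1 / gamma, and so the number of entries
  becomes the diversity order. The disc is caught between two squares.\<close>

lemma complex_gaussian_ball:
  obtains c C where "0 < c" "0 < C"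
    "\<And>e. 0 < e \<Longrightarrow> e \<le> 1 \<Longrightarrow> c * e\<^sup>2 \<le> measure complex_gaussian (cball 0 e)"
    "\<And>e. 0 < e \<Longrightarrow> measure complex_gaussian (cball 0 e) \<le> C * e\<^sup>2"
proof -
  interpret N: prob_space real_gaussian by (rule prob_space_real_gaussian)
  interpret NN: pair_prob_space real_gaussian real_gaussian ..
  obtain c C where cC: "0 < c" "0 < C"
    "\<And>e. 0 < e \<Longrightarrow> e \<le> 1 \<Longrightarrow> c * e \<le> measure real_gaussian {-e..e}"
    "\<And>e. 0 < e \<Longrightarrow> measure real_gaussian {-e..e} \<le> C * e"
    using real_gaussian_interval by blast
  have sp: "space real_gaussian = UNIV"
    using sets_eq_imp_space_eq [OF sets_real_gaussian] by simp
  have ball: "measure complex_gaussian (cball 0 e) =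
      measure (real_gaussian \<Otimes>\<^sub>M real_gaussian) ((\<lambda>(x, y). Complex x y) -` cball 0 e)" for e
    unfolding complex_gaussian_alt
    by (subst measure_distr) (auto simp: space_pair_measure sp)
  have meas: "(\<lambda>(x, y). Complex x y) -` cball 0 e \<in> sets (real_gaussian \<Otimes>\<^sub>M real_gaussian)" for e
    using measurable_sets [of "\<lambda>(x, y). Complex x y" "real_gaussian \<Otimes>\<^sub>M real_gaussian" borel "cball 0 e"]
    by (simp add: space_pair_measure sp)
  have square: "measure (real_gaussian \<Otimes>\<^sub>M real_gaussian) ({-e..e} \<times> {-e..e}) =
      (measure real_gaussian {-e..e})\<^sup>2" for e
    by (simp add: measure_def N.emeasure_pair_measure_Times enn2real_mult power2_eq_square)
  show ?thesis
  proof (rule that)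
    show "0 < c\<^sup>2 / 4" "0 < C\<^sup>2" using cC by auto
    fix e :: real assume e: "0 < e"
    have "measure complex_gaussian (cball 0 e) \<le> (measure real_gaussian {-e..e})\<^sup>2"
      unfolding ball square [symmetric]
    proof (intro NN.finite_measure_mono subsetI)
      fix p assume "p \<in> (\<lambda>(x, y). Complex x y) -` cball 0 e"
      then show "p \<in> {-e..e} \<times> {-e..e}"
        using abs_Re_le_cmod [of "Complex (fst p) (snd p)"] abs_Im_le_cmod [of "Complex (fst p) (snd p)"]
        by (auto simp: case_prod_unfold mem_Times_iff)
    qed auto
    also have "\<dots> \<le> (C * e)\<^sup>2"
      using cC(4) [OF e] by (intro power_mono) auto
    finally show "measure complex_gaussian (cball 0 e) \<le> C\<^sup>2 * e\<^sup>2"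
      by (simp add: power_mult_distrib)
    assume e1: "e \<le> 1"
    \<comment> \<open>A square of half side \<open>e / 2\<close> fits into the disc because the
      modulus is at most the sum of the absolute values of the two parts; hence the 4 in the
      constant.\<close>
    have "(c * (e / 2))\<^sup>2 \<le> (measure real_gaussian {-(e/2)..e/2})\<^sup>2"
      using cC(1) cC(3) [of "e / 2"] e e1 by (intro power_mono) auto
    also have "\<dots> \<le> measure complex_gaussian (cball 0 e)"
      unfolding ball square [symmetric]
    proof (intro NN.finite_measure_mono meas subsetI)
      fix p assume "p \<in> {-(e/2)..e/2} \<times> {-(e/2)..e/2}"
      then show "p \<in> (\<lambda>(x, y). Complex x y) -` cball 0 e"
        using cmod_le [of "Complex (fst p) (snd p)"] by (auto simp: case_prod_unfold)
    qed
    finally show "c\<^sup>2 / 4 * e\<^sup>2 \<le> measure complex_gaussian (cball 0 e)"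
      by (simp add: power_mult_distrib power_divide)
  qed
qed

subsection \<open>Mutual information with additive Gaussian noise\<close>

text \<open>Trades the signal in the argument for a density, so that the outputs of all inputs are
  compared over the one measure \<open>noise\<close>.\<close>

lemma nn_integral_noise_shift:
  assumes [measurable]: "h \<in> borel_measurable borel"
  shows "(\<integral>\<^sup>+w. h (a + w) \<partial>noise) = (\<integral>\<^sup>+w. ennreal (tilt a w) * h w \<partial>noise)"
proof -
  have "(\<integral>\<^sup>+w. h (a + w) \<partial>noise) = (\<integral>\<^sup>+w. h w \<partial>distr noise borel (\<lambda>w. w + a))"
    by (subst nn_integral_distr) (auto simp: add.commute)
  also have "\<dots> = (\<integral>\<^sup>+w. ennreal (tilt a w) * h w \<partial>noise)"
    unfolding noise_translate by (rule nn_integral_density) auto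
  finally show ?thesis .
qed

text \<open>For inputs \<open>z \<in> Z\<close> that are sent as \<open>a z\<close> and equiprobable, the logarithm of the joint
  density of \<open>(z, a z + w)\<close> relative to the product of the marginals.\<close>

definition info_density :: "'z set \<Rightarrow> ('z \<Rightarrow> complex^'r) \<Rightarrow> 'z \<Rightarrow> complex^'r \<Rightarrow> real" where
  "info_density Z a z w =
     log 2 (real (card Z) / (\<Sum>z'\<in>Z. exp ((norm w)\<^sup>2 - (norm (a z - a z' + w))\<^sup>2)))"

lemma borel_measurable_info_density [measurable (raw)]:
  fixes a :: "'x \<Rightarrow> 'z \<Rightarrow> complex^'r"
  assumes [measurable]: "\<And>z. (\<lambda>x. a x z) \<in> borel_measurable M" "f \<in> borel_measurable M"
  shows "(\<lambda>x. info_density Z (a x) z (f x)) \<in> borel_measurable M"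
  unfolding info_density_def by measurable

context
  fixes Z :: "'z set"
  assumes Z: "finite Z" "Z \<noteq> {}"
begin

lemma card_Z_pos: "0 < card Z"
  using Z by (simp add: card_gt_0_iff)

text \<open>The summand \<open>z' = z\<close> equals exp 0 = 1, and dropping the negative part of
  every exponent gives the upper bound.\<close>

lemma info_density_sum_bounds:
  assumes "z \<in> Z"
  shows "1 \<le> (\<Sum>z'\<in>Z. exp ((norm w)\<^sup>2 - (norm (a z - a z' + w))\<^sup>2))"
    and "(\<Sum>z'\<in>Z. exp ((norm w)\<^sup>2 - (norm (a z - a z' + w))\<^sup>2)) \<le> card Z * exp ((norm w)\<^sup>2)"
proof -
  have "1 = exp ((norm w)\<^sup>2 - (norm (a z - a z + w))\<^sup>2)" by simp
  also have "\<dots> \<le> (\<Sum>z'\<in>Z. exp ((norm w)\<^sup>2 - (norm (a z - a z' + w))\<^sup>2))"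
    using Z assms by (intro member_le_sum) auto
  finally show "1 \<le> (\<Sum>z'\<in>Z. exp ((norm w)\<^sup>2 - (norm (a z - a z' + w))\<^sup>2))" .
  have "(\<Sum>z'\<in>Z. exp ((norm w)\<^sup>2 - (norm (a z - a z' + w))\<^sup>2)) \<le> (\<Sum>z'\<in>Z. exp ((norm w)\<^sup>2))"
    by (intro sum_mono) auto
  then show "(\<Sum>z'\<in>Z. exp ((norm w)\<^sup>2 - (norm (a z - a z' + w))\<^sup>2)) \<le> card Z * exp ((norm w)\<^sup>2)"
    by simp
qed

lemma info_density_le: 
  assumes "z \<in> Z"
  shows "info_density Z a z w \<le> log 2 (card Z)"
  using info_density_sum_bounds [OF assms, where a = a and w = w] card_Z_pos
  by (auto simp: info_density_def log_divide)

lemma info_density_ge: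
  assumes "z \<in> Z"
  shows "- ((norm w)\<^sup>2 / ln 2) \<le> info_density Z a z w"
proof -
  let ?s = "\<Sum>z'\<in>Z. exp ((norm w)\<^sup>2 - (norm (a z - a z' + w))\<^sup>2)"
  note s = info_density_sum_bounds [OF assms, where a = a and w = w]
  have "ln ?s \<le> ln (card Z * exp ((norm w)\<^sup>2))"
    using s card_Z_pos by (subst ln_le_cancel_iff) auto
  also have "\<dots> = ln (card Z) + (norm w)\<^sup>2"
    using card_Z_pos by (simp add: ln_mult)
  finally show ?thesis
    using s card_Z_pos by (simp add: info_density_def log_def ln_div divide_simps)
qed

lemma integrable_info_density:
  assumes "z \<in> Z"
  shows "integrable noise (info_density Z a z)"
proof (rule Bochner_Integration.integrable_bound)
  interpret prob_space noise by (rule prob_space_noise)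
  show "integrable noise (\<lambda>w. (norm w)\<^sup>2 / ln 2 + log 2 (card Z))"
    using integrable_norm_noise by auto
  show "info_density Z a z \<in> borel_measurable noise"
    by measurable
  have "0 \<le> log 2 (card Z)"
    using card_Z_pos by simp
  then have "\<bar>info_density Z a z w\<bar> \<le> \<bar>(norm w)\<^sup>2 / ln 2 + log 2 (card Z)\<bar>" for w
    using info_density_ge [OF assms, of w a] info_density_le [OF assms, of a w]
      divide_nonneg_pos [of "(norm w)\<^sup>2" "ln 2"] by (auto simp: abs_le_iff intro: add_increasing)
  then show "AE w in noise. norm (info_density Z a z w) \<le> norm ((norm w)\<^sup>2 / ln 2 + log 2 (card Z))"
    by simp
qed

lemma nn_integral_input_noise:
  assumes [measurable]: "u \<in> borel_measurable (measure_pmf (pmf_of_set Z) \<Otimes>\<^sub>M noise)"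
  shows "(\<integral>\<^sup>+x. u x \<partial>(measure_pmf (pmf_of_set Z) \<Otimes>\<^sub>M noise)) =
    (\<Sum>z\<in>Z. \<integral>\<^sup>+w. u (z, w) \<partial>noise) / card Z"
proof -
  interpret prob_space noise by (rule prob_space_noise)
  show ?thesis
    by (subst nn_integral_fst [symmetric]) (auto simp: nn_integral_pmf_of_set Z)
qed

text \<open>Relative to the noise law, the output has density \<open>tilt (a z)\<close> given
  \<open>z\<close> and the average of these without conditioning. Mutual information is the expected
  logarithm of their quotient. Coinciding signals simply repeat a summand, so the formula holds for
  every matrix \<open>P\<close> and every rank of \<open>H\<close>.\<close>

theorem mutual_information_additive_noise:
  fixes f :: "'z \<Rightarrow> complex^'t" and g :: "complex^'t \<Rightarrow> complex^'r"
  assumes g [measurable]: "g \<in> borel_measurable borel"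
  shows "prob_space.mutual_information (measure_pmf (pmf_of_set Z) \<Otimes>\<^sub>M noise) 2 borel borel
      (\<lambda>(z, w). f z) (\<lambda>(z, w). g (f z) + w) =
    (\<Sum>z\<in>Z. \<integral>w. info_density Z (\<lambda>z. g (f z)) z w \<partial>noise) / card Z"
proof -
  let ?a = "\<lambda>z. g (f z)"
  let ?Q = "measure_pmf (pmf_of_set Z)" and ?N = "noise :: (complex^'r) measure"
  let ?M = "?Q \<Otimes>\<^sub>M ?N"
  let ?X = "\<lambda>(z, w :: complex^'r). f z" and ?Y = "\<lambda>(z, w). ?a z + w"
  let ?PX = "distr ?M borel ?X" and ?PY = "distr ?M borel ?Y"
  let ?J = "distr ?M (borel \<Otimes>\<^sub>M borel) (\<lambda>x. (?X x, ?Y x))"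
  \<comment> \<open>\<open>G\<close> will be the density of the output law relative to the noise,
    and \<open>F\<close> that of the joint law relative to the product of the marginals.\<close>
  define G where "G y = (\<Sum>z\<in>Z. tilt (?a z) y) / card Z" for y
  define F where "F = (\<lambda>(x, y). tilt (g x) y / G y)"
  interpret N: prob_space ?N by (rule prob_space_noise)
  interpret Q: prob_space ?Q by (rule measure_pmf.prob_space_axioms)
  interpret M: pair_prob_space ?Q ?N ..
  have [measurable]: "f \<in> measurable ?Q borel" "?a \<in> borel_measurable ?Q"
    by auto
  have mX [measurable]: "?X \<in> borel_measurable ?M" and mY [measurable]: "?Y \<in> borel_measurable ?M"
    by measurable
  have [measurable]: "G \<in> borel_measurable borel"
    unfolding G_def by measurable
  have [measurable]: "F \<in> borel_measurable (borel \<Otimes>\<^sub>M borel)"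
    unfolding F_def by measurable
  interpret PX: prob_space ?PX by (rule M.prob_space_distr [OF mX])
  interpret PY: prob_space ?PY by (rule M.prob_space_distr [OF mY])
  interpret PXY: pair_prob_space ?PX ?PY ..
  have Gpos: "0 < G y" for y
    using card_Z_pos Z by (auto simp: G_def intro!: divide_pos_pos sum_pos tilt_pos)
  have Fpos: "0 < F p" for p
    by (simp add: F_def case_prod_unfold Gpos tilt_pos)
  have nnX: "(\<integral>\<^sup>+x. h x \<partial>?PX) = (\<Sum>z\<in>Z. h (f z)) / card Z"
    if [measurable]: "h \<in> borel_measurable borel" for h
    by (subst nn_integral_distr) (auto simp: nn_integral_input_noise case_prod_unfold
        N.emeasure_space_1 [unfolded space_noise])
  have nnY: "(\<integral>\<^sup>+y. h y \<partial>?PY) = (\<integral>\<^sup>+y. ennreal (G y) * h y \<partial>noise)"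
    if [measurable]: "h \<in> borel_measurable borel" for h
  proof -
    have "(\<integral>\<^sup>+y. h y \<partial>?PY) = (\<Sum>z\<in>Z. \<integral>\<^sup>+w. h (?a z + w) \<partial>noise) / card Z"
      by (subst nn_integral_distr) (auto simp: nn_integral_input_noise case_prod_unfold)
    also have "\<dots> = (\<integral>\<^sup>+w. (\<Sum>z\<in>Z. ennreal (tilt (?a z) w) * h w) \<partial>noise) / card Z"
      by (simp add: nn_integral_noise_shift nn_integral_sum)
    also have "\<dots> = (\<integral>\<^sup>+w. (\<Sum>z\<in>Z. ennreal (tilt (?a z) w) * h w) / card Z \<partial>noise)"
      by (rule nn_integral_divide [symmetric]) auto
    also have "\<dots> = (\<integral>\<^sup>+y. ennreal (G y) * h y \<partial>noise)"
    proof (rule nn_integral_cong)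
      fix w
      have Gw: "ennreal (G w) = ennreal (\<Sum>z\<in>Z. tilt (?a z) w) / card Z"
        using card_Z_pos unfolding G_def ennreal_of_nat_eq_real_of_nat
        by (subst divide_ennreal) (auto intro: sum_nonneg less_imp_le tilt_pos)
      have S: "(\<Sum>z\<in>Z. ennreal (tilt (?a z) w) * h w) = ennreal (\<Sum>z\<in>Z. tilt (?a z) w) * h w"
        by (subst sum_distrib_right [symmetric], subst sum_ennreal) (auto intro: less_imp_le tilt_pos)
      show "(\<Sum>z\<in>Z. ennreal (tilt (?a z) w) * h w) / card Z = ennreal (G w) * h w"
        unfolding S Gw using ennreal_times_divide [of "h w"] by (subst (1 2) mult.commute) simp
    qed
    finally show ?thesis .
  qed
  \<comment> \<open>For each input the noise is shifted by the signal; then \<open>tilt\<close>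
    splits as \<open>G\<close> times \<open>F\<close>, and the factor \<open>G\<close> is absorbed
    into the output law.\<close>
  have J: "?J = density (?PX \<Otimes>\<^sub>M ?PY) (\<lambda>p. ennreal (F p))"
  proof (rule measure_eqI)
    fix A assume "A \<in> sets ?J"
    then have A [measurable]: "A \<in> sets (borel \<Otimes>\<^sub>M borel)" by simp
    have A' [measurable]: "A \<in> sets (?PX \<Otimes>\<^sub>M ?PY)" by (simp cong: sets_pair_measure_cong)
    have "emeasure ?J A = (\<integral>\<^sup>+p. indicator A p \<partial>?J)" by simp
    also have "\<dots> = (\<Sum>z\<in>Z. \<integral>\<^sup>+w. indicator A (f z, ?a z + w) \<partial>noise) / card Z"
      by (subst nn_integral_distr) (auto simp: nn_integral_input_noise case_prod_unfold)
    also have "\<dots> = (\<Sum>z\<in>Z. \<integral>\<^sup>+w. ennreal (tilt (?a z) w) * indicator A (f z, w) \<partial>noise) / card Z"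
      by (simp add: nn_integral_noise_shift [where h = "\<lambda>w. indicator A (_, w)"])
    also have "\<dots> = (\<Sum>z\<in>Z. \<integral>\<^sup>+y. ennreal (F (f z, y)) * indicator A (f z, y) \<partial>?PY) / card Z"
    proof -
      have "ennreal (tilt (?a z) w) = ennreal (G w) * ennreal (F (f z, w))" for z w
        using Gpos [of w] by (subst ennreal_mult [symmetric]) (auto simp: F_def tilt_pos less_imp_le)
      then show ?thesis
        by (simp add: nnY mult.assoc)
    qed
    also have "\<dots> = (\<integral>\<^sup>+x. \<integral>\<^sup>+y. ennreal (F (x, y)) * indicator A (x, y) \<partial>?PY \<partial>?PX)"
      by (rule nnX [symmetric]) measurable
    also have "\<dots> = (\<integral>\<^sup>+p. ennreal (F p) * indicator A p \<partial>(?PX \<Otimes>\<^sub>M ?PY))"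
      by (rule PY.nn_integral_fst) measurable
    also have "\<dots> = emeasure (density (?PX \<Otimes>\<^sub>M ?PY) (\<lambda>p. ennreal (F p))) A"
      by (rule emeasure_density [symmetric]) measurable
    finally show "emeasure ?J A = emeasure (density (?PX \<Otimes>\<^sub>M ?PY) (\<lambda>p. ennreal (F p))) A" .
  qed (simp cong: sets_pair_measure_cong)
  \<comment> \<open>At the output actually received, the factor \<open>?t\<close> is common to
    numerator and denominator of \<open>F\<close> and cancels.\<close>
  have logF: "log 2 (F (f z, ?a z + w)) = info_density Z ?a z w" for z w
  proof -
    let ?e = "\<lambda>z'. exp ((norm w)\<^sup>2 - (norm (?a z - ?a z' + w))\<^sup>2)"
    let ?t = "tilt (?a z) (?a z + w)"
    have "tilt (?a z') (?a z + w) = ?t * ?e z'" for z'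
      by (simp add: tilt_def exp_add [symmetric] algebra_simps)
    then have "(\<Sum>z'\<in>Z. tilt (?a z') (?a z + w)) = ?t * (\<Sum>z'\<in>Z. ?e z')"
      unfolding sum_distrib_left by (intro sum.cong refl)
    then have "F (f z, ?a z + w) = card Z / (\<Sum>z'\<in>Z. ?e z')"
      using tilt_pos [of "?a z" "?a z + w"] by (simp add: F_def G_def)
    then show ?thesis by (simp add: info_density_def)
  qed
  have mlog [measurable]: "(\<lambda>(z, w). info_density Z ?a z w) \<in> borel_measurable ?M"
  proof -
    have "(\<lambda>(z, w). log 2 (F (f z, ?a z + w))) \<in> borel_measurable ?M" by measurable
    then show ?thesis unfolding logF .
  qed
  have int: "integrable ?M (\<lambda>(z, w). info_density Z ?a z w)"
  proof (rule M.Fubini_integrable [OF mlog])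
    show "integrable ?Q (\<lambda>z. \<integral>w. norm (case (z, w) of (z, w) \<Rightarrow> info_density Z ?a z w) \<partial>noise)"
      by (rule integrable_measure_pmf_finite) (simp add: Z)
    show "AE z in ?Q. integrable noise (\<lambda>w. case (z, w) of (z, w) \<Rightarrow> info_density Z ?a z w)"
      using Z integrable_info_density by (auto simp: AE_measure_pmf_iff)
  qed
  have "prob_space.mutual_information ?M 2 borel borel ?X ?Y = KL_divergence 2 (?PX \<Otimes>\<^sub>M ?PY) ?J"
    by (rule M.mutual_information_def)
  also have "\<dots> = (\<integral>p. F p * log 2 (F p) \<partial>(?PX \<Otimes>\<^sub>M ?PY))"
    unfolding J by (rule PXY.KL_density) (auto simp: Fpos less_imp_le cong: measurable_cong_sets)
  also have "\<dots> = (\<integral>p. log 2 (F p) \<partial>?J)"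
    unfolding J by (subst integral_real_density) (auto simp: Fpos less_imp_le)
  also have "\<dots> = (\<integral>(z, w). log 2 (F (f z, ?a z + w)) \<partial>?M)"
    by (subst integral_distr) (auto simp: case_prod_unfold)
  also have "\<dots> = (\<integral>z. \<integral>w. info_density Z ?a z w \<partial>noise \<partial>?Q)"
    unfolding logF using M.integral_fst' [OF int] by simp
  also have "\<dots> = (\<Sum>z\<in>Z. \<integral>w. info_density Z ?a z w \<partial>noise) / card Z"
    by (rule integral_pmf_of_set) (fact Z)+
  finally show ?thesis by (simp add: case_prod_unfold)
qed

section \<open>Clustered and separated signals\<close>

lemma info_density_le_close:
  assumes "z \<in> Z" and close: "\<And>z'. z' \<in> Z \<Longrightarrow> norm (a z - a z') \<le> e"
  shows "info_density Z a z w \<le> (e\<^sup>2 + 2 * e * norm w) / ln 2"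
proof -
  let ?s = "\<Sum>z'\<in>Z. exp ((norm w)\<^sup>2 - (norm (a z - a z' + w))\<^sup>2)"
  \<comment> \<open>This bounds every exponent from below independently of \<open>z'\<close>, so the
    sum is at least \<open>card Z\<close> times one exponential, and \<open>card Z\<close> cancels
    in the quotient.\<close>
  have "(norm (a z - a z' + w))\<^sup>2 \<le> (e + norm w)\<^sup>2" if "z' \<in> Z" for z'
    using norm_triangle_ineq [of "a z - a z'" w] close [OF that] by (intro power_mono) auto
  then have "- (e\<^sup>2 + 2 * e * norm w) \<le> (norm w)\<^sup>2 - (norm (a z - a z' + w))\<^sup>2" if "z' \<in> Z" for z'
    using that by (fastforce simp: power2_eq_square algebra_simps)
  then have "(\<Sum>z'\<in>Z. exp (- (e\<^sup>2 + 2 * e * norm w))) \<le> ?s"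
    by (intro sum_mono) auto
  then have "card Z * exp (- (e\<^sup>2 + 2 * e * norm w)) \<le> ?s" by simp
  then have "ln (card Z * exp (- (e\<^sup>2 + 2 * e * norm w))) \<le> ln ?s"
    using card_Z_pos info_density_sum_bounds [OF \<open>z \<in> Z\<close>, where a = a and w = w]
    by (subst ln_le_cancel_iff) auto
  then have "ln (card Z) - ln ?s \<le> e\<^sup>2 + 2 * e * norm w"
    using card_Z_pos by (simp add: ln_mult)
  then show ?thesis
    using card_Z_pos info_density_sum_bounds [OF \<open>z \<in> Z\<close>, where a = a and w = w]
    by (simp add: info_density_def log_def ln_div divide_right_mono)
qed

text \<open>The parallelogram bound \<open>\<bar>d + w\<bar>\<^sup>2 \<ge> \<bar>d\<bar>\<^sup>2 / 2 - \<bar>w\<bar>\<^sup>2\<close> produces the exponent.\<close>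

lemma info_density_ge_separated:
  assumes "z \<in> Z" and "0 \<le> T"
    and sep: "\<And>z'. z' \<in> Z \<Longrightarrow> z' \<noteq> z \<Longrightarrow> T \<le> norm (a z - a z')"
  shows "log 2 (card Z) - log 2 (1 + card Z * exp (2 * (norm w)\<^sup>2 - T\<^sup>2 / 2)) \<le> info_density Z a z w"
proof -
  let ?e = "\<lambda>z'. exp ((norm w)\<^sup>2 - (norm (a z - a z' + w))\<^sup>2)"
  let ?b = "exp (2 * (norm w)\<^sup>2 - T\<^sup>2 / 2)"
  have e: "?e z' \<le> ?b" if "z' \<in> Z" "z' \<noteq> z" for z'
  proof -
    have "T\<^sup>2 \<le> (norm (a z - a z'))\<^sup>2"
      using sep [OF that] \<open>0 \<le> T\<close> by (intro power_mono)
    also have "\<dots> \<le> (norm (a z - a z' + w) + norm w)\<^sup>2"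
      using norm_triangle_ineq4 [of "a z - a z' + w" w] by (intro power_mono) auto
    also have "\<dots> \<le> 2 * (norm (a z - a z' + w))\<^sup>2 + 2 * (norm w)\<^sup>2"
      using zero_le_power2 [of "norm (a z - a z' + w) - norm w"]
      by (simp add: power2_eq_square algebra_simps)
    finally show ?thesis by simp
  qed
  \<comment> \<open>The summand of \<open>z\<close> itself is exactly 1; only the other inputs
    profit from the separation.\<close>
  have "(\<Sum>z'\<in>Z. ?e z') = ?e z + (\<Sum>z'\<in>Z - {z}. ?e z')"
    using Z \<open>z \<in> Z\<close> by (simp add: sum.remove)
  also have "\<dots> \<le> 1 + (\<Sum>z'\<in>Z - {z}. ?b)"
    using e by (intro add_mono sum_mono) auto
  also have "\<dots> \<le> 1 + card Z * ?b"
    using Z \<open>z \<in> Z\<close> by (auto simp: intro!: mult_right_mono)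
  finally have "log 2 (\<Sum>z'\<in>Z. ?e z') \<le> log 2 (1 + card Z * ?b)"
    using info_density_sum_bounds [OF \<open>z \<in> Z\<close>, where a = a and w = w] by simp
  then show ?thesis
    using card_Z_pos info_density_sum_bounds [OF \<open>z \<in> Z\<close>, where a = a and w = w]
    by (auto simp: info_density_def log_divide)
qed

end

text \<open>A bound for the information lost by \<open>n\<close> equiprobable signals at mutual
  distance at least \<open>T\<close>. It sees neither the SNR nor \<open>H\<close> nor
  \<open>P\<close>, which is the source of uniformity in the channel. The type argument carries the
  dimension of the noise.\<close>

definition info_deficit :: "'r::finite itself \<Rightarrow> nat \<Rightarrow> real \<Rightarrow> real" where
  "info_deficit _ n T = (\<integral>w. log 2 (1 + n * exp (2 * (norm w)\<^sup>2 - T\<^sup>2 / 2)) \<partial>(noise :: (complex^'r) measure))"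

text \<open>The upper bound is free of \<open>T\<close> and linear in u = |w|^2, hence an integrable
  majorant when \<open>T\<close> tends to infinity.\<close>

lemma info_deficit_integrand_bounds:
  "0 \<le> log 2 (1 + real n * exp (2 * u - T\<^sup>2 / 2))"
  "0 \<le> u \<Longrightarrow> log 2 (1 + real n * exp (2 * u - T\<^sup>2 / 2)) \<le> log 2 (1 + real n) + 2 * u / ln 2"
proof -
  show "0 \<le> log 2 (1 + real n * exp (2 * u - T\<^sup>2 / 2))"
    by (simp add: add_pos_nonneg)
  assume "0 \<le> u"
  have "1 + real n * exp (2 * u - T\<^sup>2 / 2) \<le> (1 + real n) * exp (2 * u)"
  proof -
    have "real n * exp (2 * u - T\<^sup>2 / 2) \<le> real n * exp (2 * u)" by (intro mult_left_mono) auto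
    moreover have "1 \<le> exp (2 * u)" using \<open>0 \<le> u\<close> by simp
    ultimately have "1 + real n * exp (2 * u - T\<^sup>2 / 2) \<le> exp (2 * u) + real n * exp (2 * u)"
      by (intro add_mono)
    then show ?thesis by (simp add: distrib_right)
  qed
  then have "log 2 (1 + real n * exp (2 * u - T\<^sup>2 / 2)) \<le> log 2 ((1 + real n) * exp (2 * u))"
    by (subst log_le_cancel_iff) (auto intro!: add_pos_nonneg)
  then show "log 2 (1 + real n * exp (2 * u - T\<^sup>2 / 2)) \<le> log 2 (1 + real n) + 2 * u / ln 2"
    using ln_mult [of "1 + real n" "exp (2 * u)"] by (simp add: log_def add_divide_distrib [symmetric])
qed

lemma integrable_info_deficit_bound:
  fixes n :: nat
  shows "integrable (noise :: (complex^'r) measure) (\<lambda>w. log 2 (1 + real n) + 2 * (norm w)\<^sup>2 / ln 2)"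
proof -
  interpret prob_space "noise :: (complex^'r) measure" by (rule prob_space_noise)
  have "integrable (noise :: (complex^'r) measure) (\<lambda>w. 2 / ln 2 * (norm w)\<^sup>2)"
    by (rule integrable_mult_right) (rule integrable_norm_noise)
  then show ?thesis by auto
qed

lemma integrable_info_deficit:
  fixes n :: nat
  shows "integrable (noise :: (complex^'r) measure) (\<lambda>w. log 2 (1 + n * exp (2 * (norm w)\<^sup>2 - T\<^sup>2 / 2)))"
  by (rule Bochner_Integration.integrable_bound [OF integrable_info_deficit_bound [where n = n]])
     (use info_deficit_integrand_bounds [where n = n] in \<open>auto simp: intro!: order_trans [OF _ abs_ge_self]\<close>)

lemma info_deficit_nonneg: "0 \<le> info_deficit r n T"
  unfolding info_deficit_def
  by (rule integral_nonneg_AE) (use info_deficit_integrand_bounds(1) in auto)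

lemma info_deficit_tendsto_0: "(info_deficit TYPE('r::finite) n \<longlongrightarrow> 0) at_top"
proof -
  have "((\<lambda>T. \<integral>w. log 2 (1 + n * exp (2 * (norm w)\<^sup>2 - T\<^sup>2 / 2)) \<partial>(noise :: (complex^'r) measure)) \<longlongrightarrow>
      (\<integral>w. 0 \<partial>(noise :: (complex^'r) measure))) at_top"
  proof (rule integral_dominated_convergence_at_top [where w = "\<lambda>w. log 2 (1 + real n) + 2 * (norm w)\<^sup>2 / ln 2"])
    show "\<forall>\<^sub>F T in at_top. AE w in noise. norm (log 2 (1 + n * exp (2 * (norm w)\<^sup>2 - T\<^sup>2 / 2)))
        \<le> log 2 (1 + real n) + 2 * (norm (w :: complex^'r))\<^sup>2 / ln 2"
      using info_deficit_integrand_bounds [where n = n] by (intro always_eventually) auto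
    show "AE w :: complex^'r in noise. ((\<lambda>T. log 2 (1 + n * exp (2 * (norm w)\<^sup>2 - T\<^sup>2 / 2))) \<longlongrightarrow> 0) at_top"
      by (intro AE_I2) real_asymp
  qed (simp_all add: integrable_info_deficit_bound)
  then show ?thesis by (simp add: info_deficit_def [abs_def])
qed

subsection \<open>Haar measure on the unitary group\<close>

lemma borel_measurable_matrix_vector_mult [measurable (raw)]:
  fixes f :: "'a \<Rightarrow> complex^'n^'m"
  assumes [measurable]: "f \<in> borel_measurable M" "g \<in> borel_measurable M"
  shows "(\<lambda>x. f x *v g x) \<in> borel_measurable M"
  unfolding matrix_vector_mult_def by measurable

lemma borel_measurable_matrix_matrix_mult [measurable (raw)]:
  fixes f :: "'a \<Rightarrow> complex^'n^'m" and g :: "'a \<Rightarrow> complex^'k^'n"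
  assumes [measurable]: "f \<in> borel_measurable M" "g \<in> borel_measurable M"
  shows "(\<lambda>x. f x ** g x) \<in> borel_measurable M"
  unfolding matrix_matrix_mult_def by measurable

lemma borel_measurable_conj_transpose [measurable (raw)]:
  fixes f :: "'a \<Rightarrow> complex^'n^'m"
  assumes [measurable]: "f \<in> borel_measurable M"
  shows "(\<lambda>x. conj_transpose (f x)) \<in> borel_measurable M"
proof -
  have [measurable]: "cnj \<in> borel_measurable borel"
    by (intro borel_measurable_continuous_onI continuous_intros)
  show ?thesis unfolding conj_transpose_def by measurable
qed

section \<open>The Hermitian product and complex reflections\<close>

lemma conj_transpose_conj_transpose [simp]: "conj_transpose (conj_transpose A) = A"
  by (simp add: conj_transpose_def vec_eq_iff)

lemma conj_transpose_mult:
  fixes A :: "complex^'n^'m" and B :: "complex^'k^'n"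
  shows "conj_transpose (A ** B) = conj_transpose B ** conj_transpose A"
  by (simp add: conj_transpose_def matrix_matrix_mult_def vec_eq_iff mult.commute)

lemma unitary_conj_transpose: "unitary U \<Longrightarrow> unitary (conj_transpose U)"
  by (simp add: unitary_def)

text \<open>The Hermitian product, conjugate linear in the first argument; the real inner product
  \<open>inner\<close> on this type is only its real part.\<close>

definition cdot :: "complex^'n \<Rightarrow> complex^'n \<Rightarrow> complex" where
  "cdot x y = (\<Sum>i\<in>UNIV. cnj (x $ i) * y $ i)"

lemma borel_measurable_cdot [measurable (raw)]:
  assumes [measurable]: "g \<in> borel_measurable M"
  shows "(\<lambda>x. cdot y (g x)) \<in> borel_measurable M"
  unfolding cdot_def by measurable

lemma cdot_self: "cdot x x = of_real ((norm x)\<^sup>2)"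
  by (simp add: cdot_def norm_vec_power2 complex_norm_square mult.commute del: of_real_power)

lemma cnj_cdot: "cnj (cdot x y) = cdot y x"
  by (simp add: cdot_def mult.commute)

lemma cdot_diff_left: "cdot (x - y) z = cdot x z - cdot y z"
  and cdot_diff_right: "cdot z (x - y) = cdot z x - cdot z y"
  by (simp_all add: cdot_def algebra_simps sum_subtractf)

lemma cdot_scaleR_left: "cdot (c *\<^sub>R x) y = c *\<^sub>R cdot x y"
proof -
  have "(c *\<^sub>R x) $ i = of_real c * x $ i" for i
    by (simp add: scaleR_conv_of_real [of c "x $ i"])
  then show ?thesis
    by (simp add: cdot_def sum_distrib_left scaleR_conv_of_real [of c "\<Sum>i\<in>_. _ i"] mult.assoc)
qed

lemma cdot_matrix_vector_mult: "cdot x (A *v y) = cdot (conj_transpose A *v x) y"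
proof -
  have "cdot x (A *v y) = (\<Sum>i\<in>UNIV. \<Sum>j\<in>UNIV. cnj (x $ i) * (A $ i $ j * y $ j))"
    by (simp add: cdot_def matrix_vector_mult_def sum_distrib_left)
  also have "\<dots> = (\<Sum>j\<in>UNIV. \<Sum>i\<in>UNIV. cnj (x $ i) * (A $ i $ j * y $ j))"
    by (rule sum.swap)
  also have "\<dots> = cdot (conj_transpose A *v x) y"
    by (simp add: cdot_def matrix_vector_mult_def conj_transpose_def sum_distrib_left sum_distrib_right mult_ac)
  finally show ?thesis .
qed

lemma norm_unitary_mult:
  assumes "unitary U"
  shows "norm (U *v x) = norm x"
proof -
  have "cdot (U *v x) (U *v x) = cdot x x"
    using assms by (simp add: cdot_matrix_vector_mult unitary_def matrix_vector_mul_assoc matrix_vector_mul_lid)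
  then have "(norm (U *v x))\<^sup>2 = (norm x)\<^sup>2"
    unfolding cdot_self of_real_eq_iff .
  then show ?thesis by simp
qed

text \<open>A complex reflection \<open>I - v v\<^sup>*/(v\<^sup>* x)\<close> with \<open>v = x - y\<close>.\<close>

lemma unitary_transitive:
  fixes x y :: "complex^'n"
  assumes "norm x = norm y"
  obtains V where "unitary V" "V *v x = y"
proof (cases "x = y")
  case True
  have "conj_transpose (mat 1) = (mat 1 :: complex^'n^'n)"
    by (auto simp: conj_transpose_def mat_def vec_eq_iff)
  then have "unitary (mat 1 :: complex^'n^'n)"
    by (simp add: unitary_def)
  then show ?thesis by (rule that) (simp add: True)
next
  case False
  define v where "v = x - y"
  define a where "a = cdot v x"
  define n where "n = complex_of_real ((norm v)\<^sup>2)"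
  \<comment> \<open>Equality of the norms of \<open>x\<close> and \<open>y\<close> enters here; it
    also yields \<open>a \<noteq> 0\<close>.\<close>
  have n: "n = a + cnj a"
  proof -
    have "cdot x x = cdot y y" using assms by (simp add: cdot_self)
    then show ?thesis
      unfolding n_def cdot_self [symmetric] a_def v_def
      by (simp add: cdot_diff_left cdot_diff_right cnj_cdot)
  qed
  have "n \<noteq> 0" using False by (simp add: n_def v_def)
  then have a: "a \<noteq> 0" unfolding n by auto
  have vv: "(\<Sum>i\<in>UNIV. cnj (v $ i) * v $ i) = n"
    using cdot_self [of v] by (simp add: cdot_def n_def)
  define V where "V = (\<chi> i j. (if i = j then 1 else 0) - v $ i * cnj (v $ j) / a)"
  have V': "conj_transpose V = (\<chi> i j. (if i = j then 1 else 0) - v $ i * cnj (v $ j) / cnj a)"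
    by (auto simp: V_def conj_transpose_def vec_eq_iff)
  \<comment> \<open>Two such rank one perturbations are inverse to each other when 1/b + 1/c =
    n/(bc), that is \<open>b + c = n\<close>. Since \<open>a\<close> need not be real, both orders
    of \<open>a\<close> and \<open>cnj a\<close> are wanted.\<close>
  have mult: "(\<Sum>k\<in>UNIV. ((if i = k then 1 else 0) - v $ i * cnj (v $ k) / b) *
      ((if k = j then 1 else 0) - v $ k * cnj (v $ j) / c)) = (if i = j then 1 else 0)"
    if bc: "b \<noteq> 0" "c \<noteq> 0" "b + c = n" for i j b c
  proof -
    have "((if i = k then 1 else 0) - v $ i * cnj (v $ k) / b) *
        ((if k = j then 1 else 0) - v $ k * cnj (v $ j) / c) =
      (if i = k then (if k = j then 1 else 0) - v $ k * cnj (v $ j) / c else 0)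
      - (if k = j then v $ i * cnj (v $ k) / b else 0)
      + v $ i * cnj (v $ j) / (b * c) * (cnj (v $ k) * v $ k)" for k
      by (auto simp: algebra_simps)
    then have "(\<Sum>k\<in>UNIV. ((if i = k then 1 else 0) - v $ i * cnj (v $ k) / b) *
        ((if k = j then 1 else 0) - v $ k * cnj (v $ j) / c)) =
        ((if i = j then 1 else 0) - v $ i * cnj (v $ j) / c) - v $ i * cnj (v $ j) / b
        + v $ i * cnj (v $ j) / (b * c) * n"
      by (simp add: sum.distrib sum_subtractf sum_distrib_left [symmetric] sum_divide_distrib [symmetric] vv)
    also have "\<dots> = (if i = j then 1 else 0)"
      using bc by (auto simp: field_simps)
    finally show ?thesis .
  qed
  have "unitary V"
    unfolding unitary_def V' unfolding V_def
    using mult [of a "cnj a"] mult [of "cnj a" a] a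
    by (simp add: matrix_matrix_mult_def mat_def vec_eq_iff n add.commute)
  moreover have "V *v x = y"
  proof -
    have "(V *v x) $ i = y $ i" for i
    proof -
      have "(V *v x) $ i = (\<Sum>j\<in>UNIV. (if i = j then x $ j else 0) - v $ i / a * (cnj (v $ j) * x $ j))"
        unfolding matrix_vector_mult_def V_def by (auto simp: algebra_simps intro!: sum.cong)
      also have "\<dots> = x $ i - v $ i / a * cdot v x"
        by (simp add: sum_subtractf cdot_def sum_distrib_left)
      also have "\<dots> = y $ i" using a by (simp add: a_def [symmetric]) (simp add: v_def)
      finally show ?thesis .
    qed
    then show ?thesis by (simp add: vec_eq_iff)
  qed
  ultimately show ?thesis by (rule that)
qed

section \<open>Invariance and uniqueness of Haar measure\<close>

lemma haar_unitaryD: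
  assumes "haar_unitary \<mu>"
  shows "prob_space \<mu>" "sets \<mu> = sets borel" "AE U in \<mu>. unitary U"
    "unitary V \<Longrightarrow> distr \<mu> borel (\<lambda>U. V ** U) = \<mu>"
  using assms by (auto simp: haar_unitary_def)

lemma nn_integral_haar_left:
  assumes "haar_unitary \<mu>" "unitary V" and [measurable]: "f \<in> borel_measurable borel"
  shows "(\<integral>\<^sup>+U. f (V ** U) \<partial>\<mu>) = (\<integral>\<^sup>+U. f U \<partial>\<mu>)"
proof -
  have [measurable_cong]: "sets \<mu> = sets borel" by (rule haar_unitaryD [OF assms(1)])
  have "(\<integral>\<^sup>+U. f U \<partial>\<mu>) = (\<integral>\<^sup>+U. f U \<partial>distr \<mu> borel (\<lambda>U. V ** U))"
    by (simp add: haar_unitaryD(4) [OF assms(1,2)])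
  also have "\<dots> = (\<integral>\<^sup>+U. f (V ** U) \<partial>\<mu>)"
    by (rule nn_integral_distr) measurable
  finally show ?thesis ..
qed

text \<open>The indicator of \<open>A\<close> at the product of the adjoint of \<open>U\<close> with
  \<open>V\<close> is integrated in both orders. Over \<open>V\<close> first, left invariance of
  \<open>\<mu>\<close> removes \<open>U\<close>. Over \<open>U\<close> first, the product is the
  adjoint of \<open>conj_transpose V ** U\<close>, and left invariance of \<open>\<nu>\<close>
  removes \<open>V\<close>.\<close>

lemma haar_unitary_inverse:
  assumes "haar_unitary \<mu>" "haar_unitary \<nu>"
  shows "\<mu> = distr \<nu> borel conj_transpose"
proof (rule measure_eqI)
  interpret mu: prob_space \<mu> by (rule haar_unitaryD [OF assms(1)])
  interpret nu: prob_space \<nu> by (rule haar_unitaryD [OF assms(2)])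
  interpret pair_prob_space \<mu> \<nu> ..
  have [measurable_cong]: "sets \<mu> = sets borel" by (rule haar_unitaryD [OF assms(1)])
  have [measurable_cong]: "sets \<nu> = sets borel" by (rule haar_unitaryD [OF assms(2)])
  fix A assume "A \<in> sets \<mu>"
  then have [measurable]: "A \<in> sets borel" using haar_unitaryD(2) [OF assms(1)] by simp
  let ?f = "indicator A :: _ \<Rightarrow> ennreal"
  have "emeasure \<mu> A = (\<integral>\<^sup>+U. \<integral>\<^sup>+V. ?f V \<partial>\<mu> \<partial>\<nu>)"
    by (simp add: nu.emeasure_space_1)
  also have "\<dots> = (\<integral>\<^sup>+U. \<integral>\<^sup>+V. ?f (conj_transpose U ** V) \<partial>\<mu> \<partial>\<nu>)"
  proof (rule nn_integral_cong_AE)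
    show "AE U in \<nu>. (\<integral>\<^sup>+V. ?f V \<partial>\<mu>) = (\<integral>\<^sup>+V. ?f (conj_transpose U ** V) \<partial>\<mu>)"
      using haar_unitaryD(3) [OF assms(2)]
      by eventually_elim
         (rule nn_integral_haar_left [OF assms(1), symmetric], auto intro: unitary_conj_transpose)
  qed
  also have "\<dots> = (\<integral>\<^sup>+V. \<integral>\<^sup>+U. ?f (conj_transpose U ** V) \<partial>\<nu> \<partial>\<mu>)"
    by (rule Fubini') measurable
  also have "\<dots> = (\<integral>\<^sup>+V. \<integral>\<^sup>+U. ?f (conj_transpose U) \<partial>\<nu> \<partial>\<mu>)"
  proof (rule nn_integral_cong_AE)
    show "AE V in \<mu>. (\<integral>\<^sup>+U. ?f (conj_transpose U ** V) \<partial>\<nu>) = (\<integral>\<^sup>+U. ?f (conj_transpose U) \<partial>\<nu>)"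
      using haar_unitaryD(3) [OF assms(1)]
    proof eventually_elim
      case (elim V)
      have "(\<integral>\<^sup>+U. ?f (conj_transpose (conj_transpose V ** U)) \<partial>\<nu>) = (\<integral>\<^sup>+U. ?f (conj_transpose U) \<partial>\<nu>)"
        by (rule nn_integral_haar_left [OF assms(2) unitary_conj_transpose [OF elim]]) measurable
      then show ?case by (simp add: conj_transpose_mult)
    qed
  qed
  also have "\<dots> = (\<integral>\<^sup>+U. ?f U \<partial>distr \<nu> borel conj_transpose)"
    by (subst nn_integral_distr) (simp_all add: mu.emeasure_space_1)
  finally show "emeasure \<mu> A = emeasure (distr \<nu> borel conj_transpose) A" by simp
qed (use haar_unitaryD [OF assms(1)] in simp)

text \<open>Both measures are the image of \<open>\<nu>\<close> under inversion. This makes the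
  precoders identically distributed.\<close>

lemma haar_unitary_unique: "haar_unitary \<mu> \<Longrightarrow> haar_unitary \<nu> \<Longrightarrow> \<mu> = \<nu>"
  using haar_unitary_inverse [of \<mu> \<nu>] haar_unitary_inverse [of \<nu> \<nu>] by simp

text \<open>If the unitary \<open>V\<close> takes \<open>x\<close> to \<open>y\<close>, it moves to
  the other side of the product as its adjoint, where left invariance absorbs it.\<close>

lemma haar_cdot_invariant:
  assumes "haar_unitary \<mu>" "norm x = norm y" and [measurable]: "A \<in> sets borel"
  shows "measure \<mu> {U. cdot x (U *v d) \<in> A} = measure \<mu> {U. cdot y (U *v d) \<in> A}"
proof -
  have s [measurable_cong]: "sets \<mu> = sets borel" by (rule haar_unitaryD [OF assms(1)])
  have sp: "space \<mu> = UNIV" using sets_eq_imp_space_eq [OF s] by simp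
  obtain V where V: "unitary V" "V *v x = y" by (rule unitary_transitive [OF assms(2)])
  have [measurable]: "{U. cdot x (U *v d) \<in> A} \<in> sets borel"
    using measurable_sets_borel [OF borel_measurable_cdot assms(3), of "\<lambda>U. U *v d" x]
    by (simp add: vimage_def)
  have "measure \<mu> {U. cdot x (U *v d) \<in> A} =
      measure (distr \<mu> borel (\<lambda>U. conj_transpose V ** U)) {U. cdot x (U *v d) \<in> A}"
    by (simp add: haar_unitaryD(4) [OF assms(1) unitary_conj_transpose [OF V(1)]])
  also have "\<dots> = measure \<mu> ((\<lambda>U. conj_transpose V ** U) -` {U. cdot x (U *v d) \<in> A})"
    by (subst measure_distr) (auto simp: sp)
  also have "(\<lambda>U. conj_transpose V ** U) -` {U. cdot x (U *v d) \<in> A} = {U. cdot y (U *v d) \<in> A}"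
    using V(2) by (simp add: vimage_def matrix_vector_mul_assoc [symmetric] cdot_matrix_vector_mult [of x "conj_transpose V"])
  finally show ?thesis .
qed

text \<open>The random vector \<open>U d\<close> is nonzero, so a Vandermonde argument shows that it is orthogonal to
  only finitely many of the vectors \<open>(j\<^sup>0, j\<^sup>1, j\<^sup>2, \<dots>)\<close>; but being orthogonal to a fixed vector has
  the same probability for all of them.\<close>

lemma haar_cdot_null:
  fixes \<mu> :: "(complex^'n^'n) measure"
  assumes haar: "haar_unitary \<mu>" and "d \<noteq> 0" "x \<noteq> 0"
  shows "measure \<mu> {U. cdot x (U *v d) = 0} = 0"
proof -
  interpret prob_space \<mu> by (rule haar_unitaryD [OF haar])
  have s [measurable_cong]: "sets \<mu> = sets borel" by (rule haar_unitaryD [OF haar])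
  have sp: "space \<mu> = UNIV" using sets_eq_imp_space_eq [OF s] by simp
  obtain idx :: "'n \<Rightarrow> nat" where idx: "inj idx"
    using finite_imp_inj_to_nat_seg [of "UNIV :: 'n set"] by auto
  \<comment> \<open>\<open>Suc j\<close> keeps the base nonzero, so that no \<open>v j\<close>
    vanishes; the entries are real, so \<open>cdot\<close> does not conjugate them visibly.\<close>
  define v :: "nat \<Rightarrow> complex^'n" where "v j = (\<chi> i. of_nat (Suc j) ^ idx i)" for j
  have v: "v j \<noteq> 0" for j by (simp add: v_def vec_eq_iff del: of_nat_Suc)
  define p where "p = measure \<mu> {U. cdot x (U *v d) = 0}"
  have p: "measure \<mu> {U. cdot (v j) (U *v d) = 0} = p" for j
  proof -
    \<comment> \<open>Invariance compares vectors of equal norm, so \<open>v j\<close> is rescaled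
      first; a nonzero factor does not affect vanishing.\<close>
    let ?c = "norm x / norm (v j)"
    have "norm (?c *\<^sub>R v j) = norm x" using v by simp
    from haar_cdot_invariant [OF haar this, of "{0}"]
    have "measure \<mu> {U. ?c *\<^sub>R cdot (v j) (U *v d) = 0} = p"
      by (simp add: p_def cdot_scaleR_left del: scaleR_eq_0_iff mult_eq_0_iff)
    moreover have "?c \<noteq> 0" using v \<open>x \<noteq> 0\<close> by simp
    ultimately show ?thesis by simp
  qed
  have meas [measurable]: "{U. cdot (v j) (U *v d) = 0} \<in> sets borel" for j
    using measurable_sets_borel [OF borel_measurable_cdot, of "\<lambda>U. U *v d" "{0}" "v j"]
    by (simp add: vimage_def)
  have fin: "finite {j. cdot (v j) u = 0}" if "u \<noteq> 0" for u
  proof -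
    \<comment> \<open>The product of \<open>v j\<close> with \<open>u\<close> is the value of this
      polynomial at j + 1, and a nonzero polynomial has finitely many roots.\<close>
    define q where "q = (\<Sum>i\<in>UNIV. monom (u $ i) (idx i))"
    have "coeff q (idx i) = u $ i" for i
      using idx by (simp add: q_def coeff_sum inj_eq if_distrib cong: if_cong)
    then have "q \<noteq> 0" using \<open>u \<noteq> 0\<close> by (metis coeff_0 vec_eq_iff zero_index)
    then have "finite {z. poly q z = 0}" by (rule poly_roots_finite)
    then have "finite ((\<lambda>j. of_nat (Suc j)) -` {z. poly q z = 0})"
      by (rule finite_vimageI) (auto simp: inj_def simp del: of_nat_Suc)
    also have "(\<lambda>j. of_nat (Suc j)) -` {z. poly q z = 0} = {j. cdot (v j) u = 0}"
      by (auto simp: q_def v_def cdot_def poly_sum poly_monom mult.commute simp del: of_nat_Suc)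
    finally show ?thesis .
  qed
  \<comment> \<open>Almost every \<open>U\<close> lies in only finitely many of these events, so
    their probabilities tend to 0; but all of them equal \<open>p\<close>.\<close>
  have "(\<lambda>j. \<integral>U. indicator {U. cdot (v j) (U *v d) = 0} U \<partial>\<mu>) \<longlonglongrightarrow> (\<integral>U. (0 :: real) \<partial>\<mu>)"
  proof (rule integral_dominated_convergence [where w = "\<lambda>_. 1"])
    show "AE U in \<mu>. (\<lambda>j. indicator {U. cdot (v j) (U *v d) = 0} U :: real) \<longlonglongrightarrow> 0"
      using haar_unitaryD(3) [OF haar]
    proof eventually_elim
      case (elim U)
      have "norm (U *v d) \<noteq> 0" using \<open>d \<noteq> 0\<close> by (simp add: norm_unitary_mult [OF elim])
      then have "finite {j. cdot (v j) (U *v d) = 0}" by (intro fin) auto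
      then have "\<forall>\<^sub>F j in sequentially. cdot (v j) (U *v d) \<noteq> 0"
        by (simp add: eventually_cofinite cofinite_eq_sequentially [symmetric])
      then show ?case
        by (intro tendsto_eventually) (auto elim!: eventually_mono)
    qed
  qed auto
  then have "(\<lambda>j. p) \<longlonglongrightarrow> 0" by (simp add: p sp)
  then show ?thesis by (simp add: p_def LIMSEQ_const_iff)
qed

text \<open>Continuity from above at the null event of orthogonality gives a threshold for one unit
  vector; invariance and scaling carry it to every \<open>x\<close>. The point is that
  \<open>\<eta>\<close> is chosen before \<open>x\<close>, which later is a row of the
  channel.\<close>

lemma haar_small_ball:
  fixes \<mu> :: "(complex^'n^'n) measure"
  assumes haar: "haar_unitary \<mu>" and "d \<noteq> 0" "0 < e"
  obtains \<eta> where "0 < \<eta>"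
    "\<And>x. x \<noteq> 0 \<Longrightarrow> measure \<mu> {U. cmod (cdot x (U *v d)) \<le> \<eta> * norm x} < e"
proof -
  interpret prob_space \<mu> by (rule haar_unitaryD [OF haar])
  have s [measurable_cong]: "sets \<mu> = sets borel" by (rule haar_unitaryD [OF haar])
  have sp: "space \<mu> = UNIV" using sets_eq_imp_space_eq [OF s] by simp
  define u :: "complex^'n" where "u = axis undefined 1"
  have u: "norm u = 1" "u \<noteq> 0" by (simp_all add: u_def)
  define B where "B k = {U. cdot u (U *v d) \<in> cball 0 (1 / real (Suc k))}" for k
  have B [measurable]: "B k \<in> sets \<mu>" for k
    using measurable_sets_borel [OF borel_measurable_cdot, of "\<lambda>U. U *v d" "cball 0 (1 / real (Suc k))" u]
    by (simp add: vimage_def B_def s)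
  have "1 / real (Suc n) \<le> 1 / real (Suc m)" if "m \<le> n" for m n
    using that by (simp add: frac_le)
  then have "decseq B"
    unfolding B_def decseq_def by (simp add: subset_eq del: of_nat_Suc) (meson order_trans)
  then have "(\<lambda>k. measure \<mu> (B k)) \<longlonglongrightarrow> measure \<mu> (\<Inter>k. B k)"
    by (intro finite_Lim_measure_decseq) auto
  also have "(\<Inter>k. B k) = {U. cdot u (U *v d) = 0}"
  proof safe
    fix U assume U: "U \<in> (\<Inter>k. B k)"
    show "cdot u (U *v d) = 0"
    proof (rule ccontr)
      assume "cdot u (U *v d) \<noteq> 0"
      then obtain k where "1 / real (Suc k) < cmod (cdot u (U *v d))"
        using nat_approx_posE [of "cmod (cdot u (U *v d))"] by auto
      moreover have "U \<in> B k" using U by blast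
      ultimately show False by (simp add: B_def)
    qed
  qed (auto simp: B_def)
  finally have "(\<lambda>k. measure \<mu> (B k)) \<longlonglongrightarrow> 0"
    by (simp add: haar_cdot_null [OF haar \<open>d \<noteq> 0\<close> u(2)])
  then have "\<forall>\<^sub>F k in sequentially. measure \<mu> (B k) < e"
    using \<open>0 < e\<close> by (rule order_tendstoD)
  then obtain k where k: "measure \<mu> (B k) < e"
    by (auto simp: eventually_sequentially)
  show ?thesis
  proof (rule that)
    show "0 < 1 / real (Suc k)" by simp
    fix x :: "complex^'n" assume x: "x \<noteq> 0"
    let ?x = "(1 / norm x) *\<^sub>R x"
    have "{U. cmod (cdot x (U *v d)) \<le> 1 / real (Suc k) * norm x} =
        {U. cdot ?x (U *v d) \<in> cball 0 (1 / real (Suc k))}"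
      using x by (simp add: cdot_scaleR_left norm_divide pos_divide_le_eq del: of_nat_Suc)
    also have "measure \<mu> \<dots> = measure \<mu> (B k)"
      unfolding B_def by (rule haar_cdot_invariant [OF haar]) (use x u in auto)
    finally show "measure \<mu> {U. cmod (cdot x (U *v d)) \<le> 1 / real (Suc k) * norm x} < e"
      using k by simp
  qed
qed

subsection \<open>A strong law of large numbers conditional on the channel\<close>

text \<open>Boundedness permits Hoeffding's inequality: the probabilities of deviations decay
  geometrically, hence are summable, and Borel-Cantelli applies.\<close>

lemma (in prob_space) bounded_iid_SLLN:
  fixes X :: "nat \<Rightarrow> 'a \<Rightarrow> real"
  assumes indep: "indep_vars (\<lambda>_. borel) X {1..}"
    and distr: "\<And>t. t \<ge> 1 \<Longrightarrow> distr M borel (X t) = distr M borel Y"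
    and Y [measurable]: "Y \<in> borel_measurable M"
    and bounded: "AE x in M. Y x \<in> {a..b}"
  shows "AE x in M. (\<lambda>N. (\<Sum>t=1..N. X t x) / real N) \<longlonglongrightarrow> expectation Y"
proof -
  have X: "random_variable borel (X t)" if "t \<ge> 1" for t
    using indep that by (auto simp: indep_vars_def)
  have [measurable]: "(\<lambda>x. \<Sum>t=1..N. X t x) \<in> borel_measurable M" for N
    by (intro borel_measurable_sum X) auto
  have "AE x in M. \<forall>\<^sub>F N in sequentially. \<bar>(\<Sum>t=1..N. X t x) / real N - expectation Y\<bar> < e"
    if e: "0 < e" for e
  proof -
    define A where "A N = {x \<in> space M. N * e \<le> \<bar>(\<Sum>t=1..N. X t x) - N * expectation Y\<bar>}" for N
    \<comment> \<open>The exponent in Hoeffding's bound for an interval enlarged to length at least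
      1, so that no division by zero occurs when \<open>a = b\<close>.\<close>
    define c where "c = 2 * e\<^sup>2 / (max 0 (b - a) + 1)\<^sup>2"
    have c: "0 < c" using e by (auto simp: c_def intro!: divide_pos_pos zero_less_power)
    have A: "prob (A N) \<le> 2 * exp (- c) ^ N" if "N \<ge> 1" for N
    proof -
      interpret Hoeffding_ineq_iid M "{1..N}" X Y a "a + (max 0 (b - a) + 1)" "expectation Y"
      proof unfold_locales
        show "indep_vars (\<lambda>_. borel) X {1..N}"
          by (rule indep_vars_subset [OF indep]) auto
        show "AE x in M. Y x \<in> {a..a + (max 0 (b - a) + 1)}"
          using bounded by eventually_elim auto
      qed (auto intro: distr)
      have "prob (A N) \<le> 2 * exp (- 2 * (N * e)\<^sup>2 / (N * (max 0 (b - a) + 1)\<^sup>2))"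
        unfolding A_def using Hoeffding_ineq_abs_ge [of "N * e"] e that by simp
      also have "- 2 * (N * e)\<^sup>2 / (N * (max 0 (b - a) + 1)\<^sup>2) = real N * (- c)"
        using that by (simp add: c_def power2_eq_square)
      finally show ?thesis by (simp only: exp_of_nat_mult)
    qed
    have "summable (\<lambda>N. 2 * exp (- c) ^ N)"
      using c by (intro summable_mult summable_geometric) simp
    then have "summable (\<lambda>N. prob (A N))"
      by (rule summable_comparison_test' [where N = 1]) (use A in auto)
    moreover have [measurable]: "A N \<in> sets M" for N
      unfolding A_def by measurable
    ultimately have "AE x in M. \<forall>\<^sub>F N in sequentially. x \<in> space M - A N"
      by (intro borel_cantelli_AE1) (auto simp: emeasure_eq_measure)
    then show ?thesis
    proof eventually_elim
      case (elim x)
      then show ?case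
        using eventually_gt_at_top [of 0]
      proof eventually_elim
        case (elim N)
        have "(\<Sum>t=1..N. X t x) / N - expectation Y = ((\<Sum>t=1..N. X t x) - N * expectation Y) / N"
          using elim by (simp add: field_simps)
        then show ?case using elim by (auto simp: A_def abs_divide field_simps)
      qed
    qed
  qed
  \<comment> \<open>Countably many tolerances suffice, so the exceptional null sets can be
    united.\<close>
  then have "AE x in M. \<forall>k. \<forall>\<^sub>F N in sequentially.
      \<bar>(\<Sum>t=1..N. X t x) / real N - expectation Y\<bar> < inverse (real (Suc k))"
    by (simp add: AE_all_countable)
  then show ?thesis
  proof eventually_elim
    case (elim x)
    show ?case
    proof (rule tendstoI)
      fix e :: real assume "0 < e"
      then obtain k where k: "inverse (real (Suc k)) < e" using reals_Archimedean by blast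
      show "\<forall>\<^sub>F N in sequentially. dist ((\<Sum>t=1..N. X t x) / real N) (expectation Y) < e"
        using elim [rule_format, of k] by eventually_elim (use k in \<open>simp add: dist_real_def\<close>)
    qed
  qed
qed

text \<open>Disjoint blocks of independent variables are independent; here the blocks are the
  singletons \<open>{h i}\<close>. It brings the coordinates \<open>Some t\<close> back to the index
  \<open>t\<close>.\<close>

lemma (in prob_space) indep_vars_reindex:
  assumes "inj_on h I" "indep_vars M' X (h ` I)"
  shows "indep_vars (\<lambda>i. M' (h i)) (\<lambda>i. X (h i)) I"
proof -
  have "indep_vars (\<lambda>i. PiM {h i} M') (\<lambda>i x. restrict (\<lambda>j. X j x) {h i}) I"
    using assms(1) by (intro indep_vars_restrict [OF assms(2)]) (auto simp: disjoint_family_on_def inj_on_def)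
  then have "indep_vars (\<lambda>i. M' (h i)) (\<lambda>i x. (\<lambda>f. f (h i)) (restrict (\<lambda>j. X j x) {h i})) I"
    by (rule indep_vars_compose2) (rule measurable_component_singleton, simp)
  then show ?thesis by simp
qed

lemma indep_vars_PiM_coordinates:
  assumes "I \<noteq> {}" and M: "\<And>i. i \<in> I \<Longrightarrow> prob_space (M i)" "\<And>i. i \<in> I \<Longrightarrow> sets (M i) = sets N"
  shows "prob_space.indep_vars (PiM I M) (\<lambda>_. N) (\<lambda>i x. x i) I"
proof -
  interpret prob_space "PiM I M" by (intro prob_space_PiM M)
  have N: "distr (PiM I M) N (\<lambda>x. x i) = M i" if "i \<in> I" for i
  proof -
    have "distr (PiM I M) N (\<lambda>x. x i) = distr (PiM I M) (M i) (\<lambda>x. x i)"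
      by (rule distr_cong) (simp_all add: M that)
    then show ?thesis using distr_PiM_component [OF M(1) that] by simp
  qed
  have s: "sets (PiM I (\<lambda>_. N)) = sets (PiM I M)"
    by (rule sets_PiM_cong) (auto simp: M)
  have "distr (PiM I M) (PiM I (\<lambda>_. N)) (\<lambda>x. \<lambda>i\<in>I. x i) = distr (PiM I M) (PiM I (\<lambda>_. N)) (\<lambda>x. x)"
    by (rule distr_cong) (auto simp: space_PiM)
  also have "\<dots> = PiM I M" using s by (rule distr_id2 [unfolded id_def])
  also have "\<dots> = PiM I (\<lambda>i. distr (PiM I M) N (\<lambda>x. x i))"
    by (rule PiM_cong) (simp_all add: N)
  moreover have "random_variable N (\<lambda>x. x i)" if "i \<in> I" for i
    using measurable_component_singleton [OF that, of M] M(2) [OF that]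
    by (simp cong: measurable_cong_sets)
  ultimately show ?thesis
    by (subst indep_vars_iff_distr_eq_PiM') (auto simp: \<open>I \<noteq> {}\<close>)
qed

text \<open>To apply the product measure machinery, which wants all variables in one space, \<open>H\<close> and
  \<open>P t\<close> are padded to pairs.\<close>

lemma (in prob_space) conditional_SLLN:
  fixes H :: "'a \<Rightarrow> 'h::second_countable_topology" and P :: "nat \<Rightarrow> 'a \<Rightarrow> 'p::second_countable_topology"
  assumes H [measurable]: "H \<in> borel_measurable M"
    and P: "\<And>t. t \<ge> 1 \<Longrightarrow> P t \<in> borel_measurable M"
    and P_distr: "\<And>t. t \<ge> 1 \<Longrightarrow> distr M borel (P t) = \<mu>"
    and indep: "indep_sets (case_option {H -` A \<inter> space M |A. A \<in> sets borel}
        (\<lambda>t. {P t -` A \<inter> space M |A. A \<in> sets borel})) (insert None (Some ` {1..}))"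
    and F [measurable]: "F \<in> borel_measurable (borel \<Otimes>\<^sub>M borel)"
    and bounded: "\<And>h p. F (h, p) \<in> {a..b}"
  shows "AE x in M. (\<lambda>N. (\<Sum>t=1..N. F (H x, P t x)) / real N) \<longlonglongrightarrow> (\<integral>p. F (H x, p) \<partial>\<mu>)"
proof -
  define J where "J = Some ` {1 :: nat ..}"
  define N where "N = (borel :: 'h measure) \<Otimes>\<^sub>M (borel :: 'p measure)"
  define X where "X i x = (case i of None \<Rightarrow> (H x, undefined) | Some t \<Rightarrow> (undefined, P t x))" for i x
  let ?I = "insert None J"
  have P1 [measurable]: "P (Suc 0) \<in> borel_measurable M" using P [of 1] by simp
  have s [measurable_cong]: "sets \<mu> = sets borel" using P_distr [of 1] by auto
  interpret mu: prob_space \<mu>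
    unfolding P_distr [of 1, simplified, symmetric] by (rule prob_space_distr) measurable
  have rv: "X i \<in> measurable M N" if "i \<in> ?I" for i
    using that P unfolding X_def N_def J_def by (auto simp: X_def)
  have indep_X: "indep_vars (\<lambda>_. N) X ?I"
    unfolding indep_vars_def2
  proof (intro conjI ballI rv)
    show "indep_sets (\<lambda>i. {X i -` A \<inter> space M |A. A \<in> sets N}) ?I"
    proof (rule indep_sets_mono_sets [OF indep [folded J_def]])
      fix i assume "i \<in> ?I"
      have sec: "(\<lambda>h. (h, undefined)) -` A \<in> sets (borel :: 'h measure)"
        "(\<lambda>p. (undefined, p)) -` A \<in> sets (borel :: 'p measure)" if "A \<in> sets N" for A
        using measurable_sets [of "\<lambda>h. (h, undefined)" "borel :: 'h measure" N A]
          measurable_sets [of "\<lambda>p. (undefined, p)" "borel :: 'p measure" N A] that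
        by (auto simp: N_def)
      show "{X i -` A \<inter> space M |A. A \<in> sets N} \<subseteq>
        case_option {H -` A \<inter> space M |A. A \<in> sets borel}
          (\<lambda>t. {P t -` A \<inter> space M |A. A \<in> sets borel}) i"
      proof (cases i)
        case None
        have "X None -` A \<inter> space M = H -` ((\<lambda>h. (h, undefined)) -` A) \<inter> space M" for A
          by (auto simp: X_def)
        note eq = this
        show ?thesis
        proof
          fix B assume "B \<in> {X i -` A \<inter> space M |A. A \<in> sets N}"
          then obtain A where A: "A \<in> sets N" and B: "B = X i -` A \<inter> space M" by auto
          have "B = H -` ((\<lambda>h. (h, undefined)) -` A) \<inter> space M" using B eq [of A] by (simp only: None)
          then show "B \<in> (case i of None \<Rightarrow> {H -` A \<inter> space M |A. A \<in> sets borel}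
              | Some t \<Rightarrow> {P t -` A \<inter> space M |A. A \<in> sets borel})"
            unfolding None option.case using sec(1) [OF A] by (intro CollectI exI conjI)
        qed
      next
        case (Some t)
        have "X (Some t) -` A \<inter> space M = P t -` ((\<lambda>p. (undefined, p)) -` A) \<inter> space M" for A
          by (auto simp: X_def)
        note eq = this
        show ?thesis
        proof
          fix B assume "B \<in> {X i -` A \<inter> space M |A. A \<in> sets N}"
          then obtain A where A: "A \<in> sets N" and B: "B = X i -` A \<inter> space M" by auto
          have "B = P t -` ((\<lambda>p. (undefined, p)) -` A) \<inter> space M" using B eq [of A] by (simp only: Some)
          then show "B \<in> (case i of None \<Rightarrow> {H -` A \<inter> space M |A. A \<in> sets borel}
              | Some t \<Rightarrow> {P t -` A \<inter> space M |A. A \<in> sets borel})"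
            unfolding Some option.case using sec(2) [OF A] by (intro CollectI exI conjI)
        qed
      qed
    qed
  qed
  define D where "D i = distr M N (X i)" for i
  have D: "prob_space (D i)" "sets (D i) = sets N" if "i \<in> ?I" for i
    using prob_space_distr [OF rv [OF that]] by (simp_all add: D_def)
  have D' [measurable_cong]: "sets (PiM J D) = sets (PiM J (\<lambda>_. N))" "sets (D None) = sets N"
    by (intro sets_PiM_cong) (auto simp: D)
  have DI [measurable_cong]: "sets (PiM ?I D) = sets (PiM ?I (\<lambda>_. N))"
    by (intro sets_PiM_cong) (auto simp: D)
  \<comment> \<open>Convergence as a property of the whole trajectory; its limit depends on the
    channel coordinate \<open>None\<close> only.\<close>
  define Q where "Q y \<longleftrightarrow> (\<lambda>n. (\<Sum>t=1..n. F (fst (y None), snd (y (Some t)))) / real n)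
      \<longlonglongrightarrow> (\<integral>p. F (fst (y None), p) \<partial>\<mu>)" for y
  have fst_None [measurable]: "(\<lambda>y. fst (y None)) \<in> borel_measurable (PiM ?I (\<lambda>_. N))"
    using measurable_component_singleton [of None ?I "\<lambda>_. N"] unfolding N_def
    by (rule measurable_compose) auto
  have snd_Some: "(\<lambda>y. snd (y (Some t))) \<in> borel_measurable (PiM ?I (\<lambda>_. N))" if "t \<ge> 1" for t
  proof -
    have "(\<lambda>y. y (Some t)) \<in> measurable (PiM ?I (\<lambda>_. N)) N"
      by (rule measurable_component_singleton) (use that in \<open>auto simp: J_def\<close>)
    from measurable_compose [OF this, of snd borel] show ?thesis
      by (simp add: N_def)
  qed
  have Q_meas [measurable]: "Measurable.pred (PiM ?I (\<lambda>_. N)) Q"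
  proof -
    have [measurable]: "(\<lambda>y. \<Sum>t=1..n. F (fst (y None), snd (y (Some t)))) \<in> borel_measurable (PiM ?I (\<lambda>_. N))" for n
      using snd_Some by (intro borel_measurable_sum measurable_compose [OF _ F] measurable_Pair fst_None) auto
    have [measurable]: "(\<lambda>h. \<integral>p. F (h, p) \<partial>\<mu>) \<in> borel_measurable borel"
      by (rule mu.borel_measurable_lebesgue_integral) measurable
    show ?thesis unfolding Q_def by measurable
  qed
  \<comment> \<open>With the channel frozen at \<open>z\<close> the remaining coordinates are
    independent with a common law, and the ordinary law of large numbers applies.\<close>
  have "AE y in PiM J D. Q (y(None := z))" for z
  proof -
    interpret J: prob_space "PiM J D" by (intro prob_space_PiM D) auto
    have ne: "J \<noteq> {}" by (auto simp: J_def)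
    have "J.indep_vars (\<lambda>_. N) (\<lambda>i y. y i) (Some ` {1..})"
      unfolding J_def [symmetric] by (rule indep_vars_PiM_coordinates [OF ne]) (use D in auto)
    from J.indep_vars_reindex [OF _ this]
    have "J.indep_vars (\<lambda>_. N) (\<lambda>t y. y (Some t)) {1..}" by simp
    then have ind: "J.indep_vars (\<lambda>_. borel) (\<lambda>t y. F (fst z, snd (y (Some t)))) {1..}"
      by (rule J.indep_vars_compose2) (auto simp: N_def)
    have comp: "distr (PiM J D) borel (\<lambda>y. F (fst z, snd (y (Some t)))) = distr \<mu> borel (\<lambda>p. F (fst z, p))"
      if "t \<ge> 1" for t
    proof -
      have t: "Some t \<in> J" using that by (auto simp: J_def)
      then have [measurable]: "(\<lambda>y. y (Some t)) \<in> measurable (PiM J D) N"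
        using measurable_component_singleton [OF t, of D] D(2) [of "Some t"]
        by (simp cong: measurable_cong_sets)
      have "distr (PiM J D) borel (\<lambda>y. F (fst z, snd (y (Some t)))) =
          distr (distr (PiM J D) (D (Some t)) (\<lambda>y. y (Some t))) borel (\<lambda>q. F (fst z, snd q))"
        using t D(2) [of "Some t"]
        by (subst distr_distr) (auto simp: comp_def N_def [symmetric] D cong: measurable_cong_sets,
            auto simp: N_def)
      also have "distr (PiM J D) (D (Some t)) (\<lambda>y. y (Some t)) = distr M N (X (Some t))"
        unfolding D_def [symmetric] by (rule distr_PiM_component) (use t D in auto)
      also have "distr \<dots> borel (\<lambda>q. F (fst z, snd q)) = distr M borel (\<lambda>x. F (fst z, P t x))"
        using rv [of "Some t"] t
        by (subst distr_distr) (auto simp: comp_def N_def X_def)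
      also have "\<dots> = distr (distr M borel (P t)) borel (\<lambda>p. F (fst z, p))"
        using P [OF that] by (subst distr_distr) (auto simp: comp_def)
      finally show ?thesis unfolding P_distr [OF that] .
    qed
    have m1: "(\<lambda>y. F (fst z, snd (y (Some 1)))) \<in> borel_measurable (PiM J D)"
      using ind by (auto simp: J.indep_vars_def)
    have "AE y in PiM J D. (\<lambda>n. (\<Sum>t=1..n. F (fst z, snd (y (Some t)))) / real n) \<longlonglongrightarrow>
        J.expectation (\<lambda>y. F (fst z, snd (y (Some 1))))"
      by (rule J.bounded_iid_SLLN [OF ind _ m1, of a b]) (use bounded comp in auto)
    also have "J.expectation (\<lambda>y. F (fst z, snd (y (Some 1)))) = (\<integral>x. x \<partial>distr \<mu> borel (\<lambda>p. F (fst z, p)))"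
      unfolding comp [OF order_refl, symmetric] by (rule integral_distr [symmetric]) (use m1 in auto)
    also have "\<dots> = (\<integral>p. F (fst z, p) \<partial>\<mu>)"
      by (rule integral_distr) auto
    finally show ?thesis by (simp add: Q_def)
  qed
  then have 1: "AE z in D None. AE y in PiM J D. Q ((\<lambda>(z, y). y(None := z)) (z, y))" by simp
  interpret DN: prob_space "D None" by (rule D) simp
  interpret DJ: prob_space "PiM J D" by (intro prob_space_PiM D) auto
  interpret DD: pair_prob_space "D None" "PiM J D" ..
  have upd: "(\<lambda>(z, y). y(None := z)) \<in> measurable (D None \<Otimes>\<^sub>M PiM J D) (PiM ?I (\<lambda>_. N))"
    unfolding case_prod_unfold
    by (rule measurable_fun_upd [where J = J]) (auto simp: D(2) D' cong: measurable_cong_sets)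
  have "{p \<in> space (D None \<Otimes>\<^sub>M PiM J D). Q ((\<lambda>(z, y). y(None := z)) p)} \<in> sets (D None \<Otimes>\<^sub>M PiM J D)"
    using measurable_compose [OF upd Q_meas] by simp
  from DD.AE_pair_measure [OF this 1]
  have 2: "AE p in D None \<Otimes>\<^sub>M PiM J D. Q ((\<lambda>(z, y). y(None := z)) p)" .
  have upd': "(\<lambda>(z, y). y(None := z)) \<in> measurable (D None \<Otimes>\<^sub>M PiM J D) (PiM ?I D)"
    using upd by (simp cong: measurable_cong_sets add: DI)
  \<comment> \<open>Inserting \<open>z\<close> at \<open>None\<close> maps the pair measure to the
    full product, which by independence is the joint law of \<open>X\<close>. This takes the
    property back to \<open>M\<close>.\<close>
  have "AE y in distr (D None \<Otimes>\<^sub>M PiM J D) (PiM ?I D) (\<lambda>(z, y). y(None := z)). Q y"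
  proof (subst AE_distr_iff [OF upd'])
    have "Measurable.pred (PiM ?I D) Q"
      using Q_meas by (simp only: measurable_cong_sets [OF DI refl])
    then show "{y \<in> space (PiM ?I D). Q y} \<in> sets (PiM ?I D)" by (rule predE)
  qed (fact 2)
  also have "distr (D None \<Otimes>\<^sub>M PiM J D) (PiM ?I D) (\<lambda>(z, y). y(None := z)) = PiM ?I D"
    by (rule distr_pair_PiM_eq_PiM) (use D in auto)
  also have "\<dots> = distr M (PiM ?I (\<lambda>_. N)) (\<lambda>x. \<lambda>i\<in>?I. X i x)"
    unfolding D_def
    by (rule sym, rule indep_vars_iff_distr_eq_PiM' [THEN iffD1, OF _ _ indep_X]) (use rv in auto)
  finally have "AE x in M. Q (\<lambda>i\<in>?I. X i x)"
    by (rule AE_distrD [rotated]) (intro measurable_restrict rv)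
  moreover have "(\<Sum>t=1..n. F (fst ((\<lambda>i\<in>?I. X i x) None), snd ((\<lambda>i\<in>?I. X i x) (Some t)))) =
      (\<Sum>t=1..n. F (H x, P t x))" for n x
    by (intro sum.cong) (auto simp: X_def J_def)
  ultimately show ?thesis
    by (simp add: Q_def X_def)
qed

subsection \<open>Information of the precoded channel\<close>

text \<open>The rank \<open>card {..<i}\<close> numbers the finite linear order by 0, 1, 2, ...
  without gaps.\<close>

lemma card_first_indices:
  assumes "k \<le> CARD('t::{finite,linorder})"
  shows "card (first_indices k :: 't set) = k"
proof -
  let ?r = "\<lambda>i :: 't. card {..<i}"
  have less: "?r i < ?r j" if "i < j" for i j
    using that by (intro psubset_card_mono) auto
  have inj: "inj ?r"
  proof (rule injI)
    fix i j assume "?r i = ?r j"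
    then show "i = j" using less [of i j] less [of j i] by (cases i j rule: linorder_cases) auto
  qed
  have sub: "range ?r \<subseteq> {..<CARD('t)}"
    by (auto intro!: psubset_card_mono)
  have "range ?r = {..<CARD('t)}"
    using card_image [OF inj] by (intro card_subset_eq sub) auto
  then have surj: "x \<in> range ?r" if "x < k" for x
    using that assms by simp
  have "?r ` first_indices k = {..<k}"
  proof safe
    fix x assume "x < k"
    from surj [OF this] obtain i where "x = ?r i" by blast
    with \<open>x < k\<close> show "x \<in> ?r ` first_indices k" by (auto simp: first_indices_def)
  qed (simp add: first_indices_def)
  moreover have "card (?r ` first_indices k) = card (first_indices k :: 't set)"
    by (rule card_image) (rule inj_on_subset [OF inj subset_UNIV])
  ultimately show ?thesis by simp
qed

definition inputs :: "complex set \<Rightarrow> nat \<Rightarrow> (complex^'t::{finite,linorder}) set" where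
  "inputs S k = vec_lambda ` PiE_dflt (first_indices k) 0 (\<lambda>_. S)"

text \<open>A product of uniform laws is uniform on the product set, which reduces the input to
  equiprobable points. Their number gives the input entropy, the coded bits per channel use.\<close>

lemma
  assumes "finite S" "S \<noteq> {}"
  shows finite_inputs: "finite (inputs S k :: (complex^'t::{finite,linorder}) set)"
    and inputs_nonempty: "(inputs S k :: (complex^'t::{finite,linorder}) set) \<noteq> {}"
    and input_pmf_eq: "(input_pmf S k :: (complex^'t::{finite,linorder}) pmf) = pmf_of_set (inputs S k)"
    and card_inputs: "k \<le> CARD('t) \<Longrightarrow> card (inputs S k :: (complex^'t::{finite,linorder}) set) = card S ^ k"
proof -
  let ?D = "PiE_dflt (first_indices k :: 't set) 0 (\<lambda>_. S)"
  have inj: "inj_on vec_lambda ?D"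
    by (auto simp: inj_on_def vec_lambda_inject)
  have fin: "finite ?D" and ne: "?D \<noteq> {}"
    using assms by (auto intro!: finite_PiE_dflt)
  show "finite (inputs S k :: (complex^'t::{finite,linorder}) set)" "(inputs S k :: (complex^'t::{finite,linorder}) set) \<noteq> {}"
    using fin ne by (auto simp: inputs_def)
  show "(input_pmf S k :: (complex^'t::{finite,linorder}) pmf) = pmf_of_set (inputs S k)"
    unfolding input_pmf_def inputs_def using assms
    by (subst Pi_pmf_of_set) (auto intro!: map_pmf_of_set_inj inj fin simp: ne)
  show "card (inputs S k :: (complex^'t::{finite,linorder}) set) = card S ^ k" if "k \<le> CARD('t)"
    unfolding inputs_def card_image [OF inj] using assms
    by (subst card_PiE_dflt) (auto simp: card_first_indices that)
qed

lemma norm_matrix_vector_mult_le: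
  fixes A :: "complex^'n^'m"
  assumes "\<And>i j. cmod (A $ i $ j) \<le> e" "0 \<le> e"
  shows "norm (A *v u) \<le> real (CARD('n) * CARD('m)) * e * norm u"
proof -
  have "norm ((A *v u) $ i) \<le> real CARD('n) * (e * norm u)" for i
  proof -
    have "cmod (A $ i $ j * u $ j) \<le> e * norm u" for j
      unfolding norm_mult by (intro mult_mono assms Finite_Cartesian_Product.norm_nth_le) auto
    then have "cmod (\<Sum>j\<in>UNIV. A $ i $ j * u $ j) \<le> (\<Sum>j\<in>(UNIV :: 'n set). e * norm u)"
      by (intro sum_norm_le)
    then show ?thesis by (simp add: matrix_vector_mult_def)
  qed
  then have "(\<Sum>i\<in>UNIV. norm ((A *v u) $ i)) \<le> (\<Sum>i\<in>(UNIV :: 'm set). real CARD('n) * (e * norm u))"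
    by (intro sum_mono)
  moreover have "norm (A *v u) \<le> (\<Sum>i\<in>UNIV. norm ((A *v u) $ i))"
    unfolding norm_vec_def by (rule L2_set_le_sum) simp
  ultimately show ?thesis by (simp add: algebra_simps)
qed

section \<open>Information bounds for a given input set\<close>

locale channel =
  fixes S :: "complex set" and n :: nat and Z :: "(complex^'t::{finite,linorder}) set" and r :: "'r::finite itself"
  assumes S: "finite S" "S \<noteq> {}"
    and Z_eq: "Z = inputs S (min CARD('t) CARD('r))"
    and n_eq: "n = card Z"
begin

lemma Z: "finite Z" "Z \<noteq> {}"
  unfolding Z_eq by (rule finite_inputs [OF S], rule inputs_nonempty [OF S])

lemma n_pos: "0 < n"
  using Z by (simp add: n_eq card_gt_0_iff)

abbreviation signal :: "real \<Rightarrow> complex^'t::{finite,linorder}^'r \<Rightarrow> complex^'t::{finite,linorder}^'t::{finite,linorder} \<Rightarrow> complex^'t::{finite,linorder} \<Rightarrow> complex^'r" where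
  "signal \<gamma> H P z \<equiv> sqrt \<gamma> *\<^sub>R (H *v (P *v z))"

lemma channel_information_eq:
  "channel_information S \<gamma> (H :: complex^'t::{finite,linorder}^'r) P =
    (\<Sum>z\<in>Z. \<integral>w. info_density Z (signal \<gamma> H P) z w \<partial>noise) / n"
proof -
  have "(\<lambda>x. sqrt \<gamma> *\<^sub>R (H *v x)) \<in> borel_measurable borel" by measurable
  from mutual_information_additive_noise [OF Z this, where f = "\<lambda>z. P *v z"]
  show ?thesis
    by (simp add: channel_information_def input_pmf_eq [OF S] Z_eq n_eq)
qed

lemma channel_information_le:
  fixes H :: "complex^'t::{finite,linorder}^'r"
  assumes "\<And>z. z \<in> Z \<Longrightarrow> (\<integral>w. info_density Z (signal \<gamma> H P) z w \<partial>noise) \<le> b"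
  shows "channel_information S \<gamma> H P \<le> b"
  using sum_bounded_above [of Z _ b, OF assms] n_pos
  by (simp add: channel_information_eq divide_le_eq n_eq [symmetric] mult.commute)

lemma channel_information_ge:
  fixes H :: "complex^'t::{finite,linorder}^'r"
  assumes "\<And>z. z \<in> Z \<Longrightarrow> b \<le> (\<integral>w. info_density Z (signal \<gamma> H P) z w \<partial>noise)"
  shows "b \<le> channel_information S \<gamma> H P"
  using sum_bounded_below [of Z b, OF assms] n_pos
  by (simp add: channel_information_eq le_divide_eq n_eq [symmetric] mult.commute)

lemma channel_information_le_log:
  fixes H :: "complex^'t::{finite,linorder}^'r"
  shows "channel_information S \<gamma> H P \<le> log 2 n"
proof (rule channel_information_le)
  interpret N: prob_space "noise :: (complex^'r) measure" by (rule prob_space_noise)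
  fix z assume z: "z \<in> Z"
  have "(\<integral>w. info_density Z (signal \<gamma> H P) z w \<partial>noise) \<le> (\<integral>w. log 2 n \<partial>(noise :: (complex^'r) measure))"
    using info_density_le [OF Z z] integrable_info_density [OF Z z]
    by (intro integral_mono) (auto simp: n_eq)
  then show "(\<integral>w. info_density Z (signal \<gamma> H P) z w \<partial>noise) \<le> log 2 n"
    by (simp add: N.prob_space [unfolded space_noise])
qed

lemma channel_information_ge_separated:
  fixes H :: "complex^'t::{finite,linorder}^'r"
  assumes "0 \<le> T"
    and "\<And>z z'. z \<in> Z \<Longrightarrow> z' \<in> Z \<Longrightarrow> z \<noteq> z' \<Longrightarrow> T \<le> norm (signal \<gamma> H P (z - z'))"
  shows "log 2 n - info_deficit TYPE('r) n T \<le> channel_information S \<gamma> H P"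
proof (rule channel_information_ge)
  interpret N: prob_space "noise :: (complex^'r) measure" by (rule prob_space_noise)
  fix z assume z: "z \<in> Z"
  have "T \<le> norm (signal \<gamma> H P z - signal \<gamma> H P z')" if "z' \<in> Z" "z' \<noteq> z" for z'
    using assms(2) [OF z that(1)] that(2)
    by (simp add: matrix_vector_mult_diff_distrib scaleR_diff_right)
  then have *: "log 2 n - log 2 (1 + n * exp (2 * (norm w)\<^sup>2 - T\<^sup>2 / 2)) \<le> info_density Z (signal \<gamma> H P) z w" for w
    unfolding n_eq by (intro info_density_ge_separated Z z assms(1))
  have "(\<integral>w. log 2 n - log 2 (1 + n * exp (2 * (norm w)\<^sup>2 - T\<^sup>2 / 2)) \<partial>(noise :: (complex^'r) measure))
      \<le> (\<integral>w. info_density Z (signal \<gamma> H P) z w \<partial>noise)"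
    using * by (intro integral_mono integrable_info_density Z z Bochner_Integration.integrable_diff
        integrable_info_deficit) auto
  then show "log 2 n - info_deficit TYPE('r) n T \<le> (\<integral>w. info_density Z (signal \<gamma> H P) z w \<partial>noise)"
    by (simp add: integrable_info_deficit info_deficit_def N.prob_space [unfolded space_noise])
qed

text \<open>Separation 0 always holds. The lower bound serves the law of large numbers and caps the
  damage done by bad precoders.\<close>

lemma channel_information_bounded:
  fixes H :: "complex^'t::{finite,linorder}^'r"
  shows "channel_information S \<gamma> H P \<in> {log 2 n - info_deficit TYPE('r) n 0 .. log 2 n}"
  using channel_information_ge_separated [of 0] channel_information_le_log by simp

lemma channel_information_le_close:
  fixes H :: "complex^'t::{finite,linorder}^'r"
  assumes "\<And>z z'. z \<in> Z \<Longrightarrow> z' \<in> Z \<Longrightarrow> norm (signal \<gamma> H P (z - z')) \<le> e"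
  shows "channel_information S \<gamma> H P \<le> (e\<^sup>2 + 2 * e * (\<integral>w. norm w \<partial>(noise :: (complex^'r) measure))) / ln 2"
proof (rule channel_information_le)
  interpret N: prob_space "noise :: (complex^'r) measure" by (rule prob_space_noise)
  fix z assume z: "z \<in> Z"
  have "norm (signal \<gamma> H P z - signal \<gamma> H P z') \<le> e" if "z' \<in> Z" for z'
    using assms [OF z that] by (simp add: matrix_vector_mult_diff_distrib scaleR_diff_right)
  then have *: "info_density Z (signal \<gamma> H P) z w \<le> (e\<^sup>2 + 2 * e * norm w) / ln 2" for w
    by (intro info_density_le_close Z z)
  have norm: "integrable (noise :: (complex^'r) measure) norm"
  proof (rule Bochner_Integration.integrable_bound)
    show "integrable (noise :: (complex^'r) measure) (\<lambda>w. 1 + (norm w)\<^sup>2)"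
      using integrable_norm_noise by auto
    have "norm w \<le> 1 + (norm w)\<^sup>2" for w :: "complex^'r"
    proof -
      have "2 * norm w \<le> 1 + (norm w)\<^sup>2"
        using zero_le_power2 [of "norm w - 1"] by (simp add: power2_eq_square algebra_simps)
      then show ?thesis using norm_ge_zero [of w] by linarith
    qed
    then show "AE w :: complex^'r in noise. norm (norm w) \<le> norm (1 + (norm w)\<^sup>2)" by simp
  qed measurable
  have "(\<integral>w. info_density Z (signal \<gamma> H P) z w \<partial>noise)
      \<le> (\<integral>w. (e\<^sup>2 + 2 * e * norm w) / ln 2 \<partial>(noise :: (complex^'r) measure))"
    using * norm by (intro integral_mono integrable_info_density Z z) auto
  also have "\<dots> = (e\<^sup>2 + 2 * e * (\<integral>w. norm w \<partial>(noise :: (complex^'r) measure))) / ln 2"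
    using norm by (simp add: N.prob_space [unfolded space_noise])
  finally show "(\<integral>w. info_density Z (signal \<gamma> H P) z w \<partial>noise)
      \<le> (e\<^sup>2 + 2 * e * (\<integral>w. norm w \<partial>(noise :: (complex^'r) measure))) / ln 2" .
qed

lemma borel_measurable_channel_information:
  "(\<lambda>x. channel_information S \<gamma> (fst x :: complex^'t::{finite,linorder}^'r) (snd x)) \<in> borel_measurable (borel \<Otimes>\<^sub>M borel)"
proof -
  interpret N: prob_space "noise :: (complex^'r) measure" by (rule prob_space_noise)
  have "(\<lambda>x. \<integral>w. info_density Z (signal \<gamma> (fst x) (snd x)) z w \<partial>noise) \<in> borel_measurable (borel \<Otimes>\<^sub>M borel)" for z
    by (rule N.borel_measurable_lebesgue_integral) measurable
  then show ?thesis unfolding channel_information_eq by measurable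
qed

text \<open>A unitary \<open>P\<close> preserves the norms of the input differences, so small
  entries of the scaled channel force all signals together. The threshold depends on
  \<open>\<rho>\<close> and the inputs alone.\<close>

lemma information_small:
  assumes "0 < \<rho>"
  obtains e where "0 < e"
    "\<And>\<gamma> (H :: complex^'t::{finite,linorder}^'r) P. 0 \<le> \<gamma> \<Longrightarrow> unitary P \<Longrightarrow> (\<And>i j. sqrt \<gamma> * cmod (H $ i $ j) \<le> e)
      \<Longrightarrow> channel_information S \<gamma> H P \<le> \<rho>"
proof -
  define E where "E = (\<integral>w. norm w \<partial>(noise :: (complex^'r) measure))"
  have E: "0 \<le> E" by (simp add: E_def)
  \<comment> \<open>The target diameter of the signal set: \<open>a \<le> 1\<close> turns a^2 + 2 a
    E into at most a (1 + 2 E), and the other bound makes this at most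
    \<open>\<rho> * ln 2\<close>.\<close>
  define a where "a = min 1 (\<rho> * ln 2 / (1 + 2 * E))"
  have "a \<le> \<rho> * ln 2 / (1 + 2 * E)" by (simp add: a_def)
  then have a: "0 < a" "a \<le> 1" "a * (1 + 2 * E) \<le> \<rho> * ln 2"
    using E assms by (auto simp: a_def le_divide_eq intro!: divide_pos_pos)
  obtain K where K: "\<And>z. z \<in> Z \<Longrightarrow> norm z \<le> K"
    using finite_imp_bounded [OF Z(1)] by (auto simp: bounded_iff)
  from Z(2) obtain z0 where "z0 \<in> Z" by blast
  then have "0 \<le> K" using K [of z0] norm_ge_zero [of z0] by linarith
  \<comment> \<open>The crude operator norm factor times a bound for input differences; the 1 keeps
    \<open>c\<close> positive when \<open>K = 0\<close>.\<close>
  define c where "c = real (CARD('t) * CARD('r)) * (2 * K + 1)"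
  have c: "0 < c" using \<open>0 \<le> K\<close> by (simp add: c_def)
  show ?thesis
  proof (rule that)
    show "0 < a / c" using a c by simp
    fix \<gamma> :: real and H :: "complex^'t::{finite,linorder}^'r"
      and P :: "complex^'t::{finite,linorder}^'t::{finite,linorder}"
    assume "0 \<le> \<gamma>" and P: "unitary P" and H: "\<And>i j. sqrt \<gamma> * cmod (H $ i $ j) \<le> a / c"
    have "channel_information S \<gamma> H P \<le> (a\<^sup>2 + 2 * a * E) / ln 2"
      unfolding E_def
    proof (rule channel_information_le_close)
      fix z z' assume z: "z \<in> Z" "z' \<in> Z"
      have "norm (z - z') \<le> 2 * K + 1"
        using norm_triangle_ineq4 [of z z'] K [OF z(1)] K [OF z(2)] by simp
      moreover have "norm (signal \<gamma> H P (z - z')) \<le>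
          real (CARD('t) * CARD('r)) * (a / c) * norm (P *v (z - z'))"
      proof -
        have "sqrt \<gamma> *\<^sub>R (H *v u) = (sqrt \<gamma> *\<^sub>R H) *v u" for u
          by (simp add: matrix_vector_mult_def vec_eq_iff scaleR_sum_right)
        then show ?thesis
          using norm_matrix_vector_mult_le [of "sqrt \<gamma> *\<^sub>R H" "a / c" "P *v (z - z')"] H a c \<open>0 \<le> \<gamma>\<close>
          by simp
      qed
      ultimately have "norm (signal \<gamma> H P (z - z')) \<le> real (CARD('t) * CARD('r)) * (a / c) * (2 * K + 1)"
        using a c unfolding norm_unitary_mult [OF P]
        by (elim order_trans) (intro mult_left_mono, auto)
      also have "\<dots> = c * (a / c)" by (simp only: c_def mult_ac)
      finally show "norm (signal \<gamma> H P (z - z')) \<le> a" using c by simp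
    qed
    also have "a\<^sup>2 + 2 * a * E \<le> a * (1 + 2 * E)"
      using a by (simp add: power2_eq_square algebra_simps mult_left_le)
    also have "\<dots> / ln 2 \<le> \<rho>"
      using a(3) by (simp add: divide_le_eq)
    finally show "channel_information S \<gamma> H P \<le> \<rho>"
      by (simp add: divide_right_mono)
  qed
qed

text \<open>The admissible loss \<open>L\<close> is split in halves: one for precoders that separate
  all signals by \<open>T\<close>, one for the exceptional precoders, where the loss is at most
  \<open>L / 2 + B\<close> but the probability is small.\<close>

lemma mean_information_large:
  fixes \<mu> :: "(complex^'t::{finite,linorder}^'t::{finite,linorder}) measure"
  assumes haar: "haar_unitary \<mu>" and "\<rho> < log 2 n"
  obtains T where "0 < T"
    "\<And>\<gamma> (H :: complex^'t::{finite,linorder}^'r) i j. 0 \<le> \<gamma> \<Longrightarrow> T \<le> sqrt \<gamma> * cmod (H $ i $ j)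
      \<Longrightarrow> \<rho> \<le> (\<integral>P. channel_information S \<gamma> H P \<partial>\<mu>)"
proof -
  interpret mu: prob_space \<mu> by (rule haar_unitaryD [OF haar])
  have s [measurable_cong]: "sets \<mu> = sets borel" by (rule haar_unitaryD [OF haar])
  have sp: "space \<mu> = UNIV" using sets_eq_imp_space_eq [OF s] by simp
  define L where "L = log 2 n - \<rho>"
  have L: "0 < L" using assms by (simp add: L_def)
  have "\<forall>\<^sub>F T in at_top. info_deficit TYPE('r) n T < L / 2"
    using L by (intro order_tendstoD(2) [OF info_deficit_tendsto_0]) simp
  then have "\<forall>\<^sub>F T in at_top. 0 < T \<and> info_deficit TYPE('r) n T < L / 2"
    using eventually_gt_at_top [of 0] by eventually_elim simp
  then obtain T where T: "0 < T" "info_deficit TYPE('r) n T < L / 2"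
    by (auto simp: eventually_at_top_linorder)
  define B where "B = info_deficit TYPE('r) n 0"
  have B: "0 \<le> B" by (simp add: B_def info_deficit_nonneg)
  define D where "D = (\<lambda>(z, z'). z - z') ` {(z, z') \<in> Z \<times> Z. z \<noteq> z'}"
  have D: "finite D" "\<And>d. d \<in> D \<Longrightarrow> d \<noteq> 0"
  proof -
    have "finite {(z, z') \<in> Z \<times> Z. z \<noteq> z'}"
      by (rule finite_subset [of _ "Z \<times> Z"]) (auto simp: Z)
    then show "finite D" unfolding D_def by (rule finite_imageI)
  qed (auto simp: D_def)
  \<comment> \<open>Chosen so that a union bound over \<open>D\<close>, times the loss
    \<open>B\<close>, stays below \<open>L / 2\<close>; the added 1s avoid zero
    denominators.\<close>
  define e where "e = L / (2 * (B + 1) * (card D + 1))"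
  have e: "0 < e" using L B by (auto simp: e_def intro!: divide_pos_pos mult_pos_pos)
  have "\<forall>d\<in>D. \<exists>\<eta>>0. \<forall>x. x \<noteq> 0 \<longrightarrow> measure \<mu> {U. cmod (cdot x (U *v d)) \<le> \<eta> * norm x} < e"
  proof
    fix d assume "d \<in> D"
    show "\<exists>\<eta>>0. \<forall>x. x \<noteq> 0 \<longrightarrow> measure \<mu> {U. cmod (cdot x (U *v d)) \<le> \<eta> * norm x} < e"
      by (rule haar_small_ball [OF haar D(2) [OF \<open>d \<in> D\<close>] e]) blast
  qed
  then obtain \<eta>' where \<eta>': "\<And>d. d \<in> D \<Longrightarrow> 0 < \<eta>' d"
    "\<And>d x. d \<in> D \<Longrightarrow> x \<noteq> 0 \<Longrightarrow> measure \<mu> {U. cmod (cdot x (U *v d)) \<le> \<eta>' d * norm x} < e"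
    by metis
  \<comment> \<open>The inserted 1 covers an empty \<open>D\<close>.\<close>
  define \<eta> where "\<eta> = Min (insert 1 (\<eta>' ` D))"
  have \<eta>: "0 < \<eta>" "\<And>d. d \<in> D \<Longrightarrow> \<eta> \<le> \<eta>' d"
    using \<eta>' D by (auto simp: \<eta>_def)
  show ?thesis
  proof (rule that)
    show "0 < T / \<eta>" using T \<eta> by simp
    fix \<gamma> :: real and H :: "complex^'t::{finite,linorder}^'r" and i j
    assume \<gamma>: "0 \<le> \<gamma>" and H: "T / \<eta> \<le> sqrt \<gamma> * cmod (H $ i $ j)"
    \<comment> \<open>The conjugated row, so that \<open>cdot x u\<close> is a component of
      \<open>H *v u\<close> and bounds its norm from below.\<close>
    define x :: "complex^'t::{finite,linorder}" where "x = (\<chi> j. cnj (H $ i $ j))"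
    have x: "cdot x u = (H *v u) $ i" for u
      by (simp add: cdot_def x_def matrix_vector_mult_def)
    have "cmod (H $ i $ j) \<le> norm x"
      using Finite_Cartesian_Product.norm_nth_le [of x j] by (simp add: x_def)
    then have "T / \<eta> \<le> sqrt \<gamma> * norm x"
      using \<gamma> by (intro order_trans [OF H] mult_left_mono) auto
    then have Tx: "T \<le> sqrt \<gamma> * (\<eta> * norm x)"
      using \<eta> by (simp add: field_simps)
    then have x0: "x \<noteq> 0" using T by auto
    define A where "A d = {U :: complex^'t::{finite,linorder}^'t::{finite,linorder}. cmod (cdot x (U *v d)) \<le> \<eta> * norm x}" for d
    have A_meas [measurable]: "A d \<in> sets \<mu>" for d
      using measurable_sets_borel [OF borel_measurable_cdot, of "\<lambda>U. U *v d" "cball 0 (\<eta> * norm x)" x]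
      by (simp add: vimage_def A_def s)
    have A: "measure \<mu> (A d) \<le> e" if "d \<in> D" for d
    proof -
      have [measurable]: "{U. cmod (cdot x (U *v d)) \<le> \<eta>' d * norm x} \<in> sets \<mu>"
        using measurable_sets_borel [OF borel_measurable_cdot, of "\<lambda>U. U *v d" "cball 0 (\<eta>' d * norm x)" x]
        by (simp add: vimage_def s)
      have "A d \<subseteq> {U. cmod (cdot x (U *v d)) \<le> \<eta>' d * norm x}"
        using \<eta>(2) [OF that] unfolding A_def
        by (auto elim!: order_trans intro!: mult_right_mono)
      then have "measure \<mu> (A d) \<le> measure \<mu> {U. cmod (cdot x (U *v d)) \<le> \<eta>' d * norm x}"
        by (intro mu.finite_measure_mono) auto
      then show ?thesis using \<eta>'(2) [OF that x0] by simp
    qed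
    let ?A = "\<Union>d\<in>D. A d"
    have "measure \<mu> ?A \<le> (\<Sum>d\<in>D. measure \<mu> (A d))"
      by (intro mu.finite_measure_subadditive_finite D) auto
    also have "\<dots> \<le> card D * e"
      using sum_bounded_above [of D "\<lambda>d. measure \<mu> (A d)" e] A by simp
    finally have muA: "measure \<mu> ?A \<le> card D * e" .
    have BA: "B * measure \<mu> ?A \<le> L / 2"
    proof -
      have "B * measure \<mu> ?A \<le> B * (card D * e)"
        using B muA by (intro mult_left_mono)
      also have "\<dots> \<le> (B + 1) * ((card D + 1) * e)"
        using B e by (intro mult_mono) auto
      also have "\<dots> = L / 2"
      proof -
        have "b * (d * (L / (2 * b * d))) = L / 2" if "b \<noteq> 0" "d \<noteq> 0" for b d :: real
          using that by simp
        from this [of "B + 1" "real (card D + 1)"] B show ?thesis by (simp add: e_def)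
      qed
      finally show ?thesis .
    qed
    have low: "log 2 n - L / 2 - B * indicator ?A U \<le> channel_information S \<gamma> H U" for U
    proof (cases "U \<in> ?A")
      case True
      then show ?thesis
        using channel_information_bounded [of \<gamma> H U] L by (simp add: B_def)
    next
      case False
      have "T \<le> norm (signal \<gamma> H U (z - z'))" if "z \<in> Z" "z' \<in> Z" "z \<noteq> z'" for z z'
      proof -
        have "z - z' \<in> D" using that by (auto simp: D_def)
        then have "\<eta> * norm x \<le> cmod (cdot x (U *v (z - z')))"
          using False by (fastforce simp: A_def)
        then have "T \<le> sqrt \<gamma> * cmod (cdot x (U *v (z - z')))"
          using \<gamma> by (intro order_trans [OF Tx] mult_left_mono) auto
        also have "\<dots> \<le> sqrt \<gamma> * norm (H *v (U *v (z - z')))"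
          unfolding x using \<gamma> by (intro mult_left_mono Finite_Cartesian_Product.norm_nth_le) auto
        also have "\<dots> = norm (signal \<gamma> H U (z - z'))"
          using \<gamma> by simp
        finally show ?thesis .
      qed
      then have "log 2 n - info_deficit TYPE('r) n T \<le> channel_information S \<gamma> H U"
        using T by (intro channel_information_ge_separated) auto
      then show ?thesis using T False by simp
    qed
    have [measurable]: "channel_information S \<gamma> H \<in> borel_measurable \<mu>"
      using measurable_compose [OF _ borel_measurable_channel_information, of "\<lambda>P. (H, P)" \<mu> \<gamma>] by simp
    have int: "integrable \<mu> (channel_information S \<gamma> H)"
    proof (rule mu.integrable_const_bound)
      have "norm (channel_information S \<gamma> H P) \<le> \<bar>log 2 n\<bar> + B" for P
        using channel_information_bounded [of \<gamma> H P] B by (auto simp: B_def)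
      then show "AE P in \<mu>. norm (channel_information S \<gamma> H P) \<le> \<bar>log 2 n\<bar> + B"
        by simp
    qed measurable
    have UA: "?A \<in> sets \<mu>"
      using D(1) by (intro sets.finite_UN) auto
    have indA: "integrable \<mu> (indicator ?A :: _ \<Rightarrow> real)"
      by (rule integrable_real_indicator [OF UA]) (simp add: less_top [symmetric])
    have "\<rho> \<le> log 2 n - L / 2 - B * measure \<mu> ?A"
      using BA by (simp add: L_def field_simps)
    also have "\<dots> = (\<integral>U. log 2 n - L / 2 - B * indicator ?A U \<partial>\<mu>)"
      using indA UA by (subst Bochner_Integration.integral_diff) (auto simp: mu.prob_space)
    also have "\<dots> \<le> (\<integral>P. channel_information S \<gamma> H P \<partial>\<mu>)"
      using low indA by (intro integral_mono int) auto
    finally show "\<rho> \<le> (\<integral>P. channel_information S \<gamma> H P \<partial>\<mu>)" .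
  qed
qed

end

subsection \<open>Outage probability\<close>

text \<open>The constants enter only through \<open>ln a / ln x\<close> and
  \<open>ln b / ln x\<close>, which vanish; this is why the estimates above may be crude.\<close>

lemma tendsto_exponent:
  fixes f :: "real \<Rightarrow> real"
  assumes "0 < a" "0 < b"
    and "\<forall>\<^sub>F x in at_top. a / x ^ n \<le> f x" "\<forall>\<^sub>F x in at_top. f x \<le> b / x ^ n"
  shows "((\<lambda>x. - ln (f x) / ln x) \<longlongrightarrow> real n) at_top"
proof (rule tendsto_sandwich)
  show "((\<lambda>x. n - ln b / ln x) \<longlongrightarrow> real n) at_top" by real_asymp
  show "((\<lambda>x. n - ln a / ln x) \<longlongrightarrow> real n) at_top" by real_asymp
  have "\<forall>\<^sub>F x in at_top. n - ln b / ln x \<le> - ln (f x) / ln x \<and> - ln (f x) / ln x \<le> n - ln a / ln x"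
    using assms(3,4) eventually_gt_at_top [of 1]
  proof eventually_elim
    case (elim x)
    have "0 < a / x ^ n" using elim \<open>0 < a\<close> by simp
    then have "ln (a / x ^ n) \<le> ln (f x)" "ln (f x) \<le> ln (b / x ^ n)"
      using elim \<open>0 < b\<close> by (auto simp: ln_le_cancel_iff intro: less_le_trans)
    then have "ln a - n * ln x \<le> ln (f x)" "ln (f x) \<le> ln b - n * ln x"
      using elim assms(1,2) by (simp_all add: ln_div ln_realpow)
    then have "n * ln x - ln b \<le> - ln (f x)" "- ln (f x) \<le> n * ln x - ln a"
      by linarith+
    from this [THEN divide_right_mono, of "ln x"] show ?case
      using elim by (simp add: diff_divide_distrib)
  qed
  then show "\<forall>\<^sub>F x in at_top. n - ln b / ln x \<le> - ln (f x) / ln x"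
    "\<forall>\<^sub>F x in at_top. - ln (f x) / ln x \<le> n - ln a / ln x"
    by (auto elim: eventually_mono)
qed

lemma (in prob_space) prob_gaussian_entries:
  fixes H :: "'a \<Rightarrow> complex^'n^'m"
  assumes indep: "indep_vars (\<lambda>_. borel) (\<lambda>(i, j) x. H x $ i $ j) UNIV"
    and distr: "\<And>i j. distr M borel (\<lambda>x. H x $ i $ j) = complex_gaussian"
  shows "prob {x \<in> space M. \<forall>i j. cmod (H x $ i $ j) \<le> e} =
    measure complex_gaussian (cball 0 e) ^ (CARD('n) * CARD('m))"
proof -
  have [measurable]: "(\<lambda>x. H x $ i $ j) \<in> borel_measurable M" for i j
    using indep by (auto simp: indep_vars_def)
  have "{x \<in> space M. \<forall>i j. cmod (H x $ i $ j) \<le> e} =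
      (\<Inter>p\<in>UNIV. (\<lambda>(i, j) x. H x $ i $ j) p -` cball 0 e \<inter> space M)"
    by auto
  also have "prob \<dots> = (\<Prod>p\<in>UNIV. prob ((\<lambda>(i, j) x. H x $ i $ j) p -` cball 0 e \<inter> space M))"
    by (rule indep_varsD [OF indep]) auto
  also have "\<dots> = (\<Prod>p\<in>(UNIV :: ('m \<times> 'n) set). measure complex_gaussian (cball 0 e))"
  proof (rule prod.cong, safe)
    fix i j
    show "prob ((\<lambda>x. H x $ i $ j) -` cball 0 e \<inter> space M) = measure complex_gaussian (cball 0 e)"
      unfolding distr [of i j, symmetric] by (subst measure_distr) auto
  qed
  finally show ?thesis by (simp add: mult.commute)
qed

theorem theorem1:
  fixes \<Omega> :: "'a measure"
    and H :: "'a \<Rightarrow> complex^'t::{finite,linorder}^'r::finite"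
    and P :: "nat \<Rightarrow> 'a \<Rightarrow> complex^'t::{finite,linorder}^'t::{finite,linorder}"
    and S :: "complex set" and q :: nat and Rc :: real
  assumes "prob_space \<Omega>"
    and "q \<ge> 1" and "card S = 2 ^ q"
    and "(\<Sum>s\<in>S. (cmod s)\<^sup>2) / real (card S) =
           (if CARD('r) \<ge> CARD('t) then 1 else real CARD('t) / real CARD('r))"
    and "0 < Rc" and "Rc < 1"
    and "prob_space.indep_vars \<Omega> (\<lambda>_. borel) (\<lambda>(i, j) \<omega>. H \<omega> $ i $ j) UNIV"
    and "\<And>i j. distr \<Omega> borel (\<lambda>\<omega>. H \<omega> $ i $ j) = complex_gaussian"
    and "\<And>t. t \<ge> 1 \<Longrightarrow> P t \<in> borel_measurable \<Omega>"
    and "\<And>t. t \<ge> 1 \<Longrightarrow> haar_unitary (distr \<Omega> borel (P t))"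
    \<comment> \<open>mutual independence of H, P 1, P 2, ...: index None stands for H, Some t for P t\<close>
    and "prob_space.indep_sets \<Omega>
           (case_option {H -` A \<inter> space \<Omega> |A. A \<in> sets borel}
                        (\<lambda>t. {P t -` A \<inter> space \<Omega> |A. A \<in> sets borel}))
           (insert None (Some ` {1..}))"
  shows "((\<lambda>\<gamma>. - ln (outage_probability \<Omega> H P S
                 (real (min CARD('t) CARD('r)) * log 2 (real (card S)) * Rc) \<gamma>) / ln \<gamma>)
           \<longlongrightarrow> real (CARD('t) * CARD('r))) at_top"
proof -
  interpret prob_space \<Omega> by fact
  define k where "k = min CARD('t) CARD('r)"
  define R where "R = real k * log 2 (real (card S)) * Rc"
  define Z :: "(complex^'t::{finite,linorder}) set" where "Z = inputs S k"
  have "0 < card S" using assms(3) by simp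
  then have S: "finite S" "S \<noteq> {}" by (auto simp: card_gt_0_iff)
  interpret channel S "card Z" Z "TYPE('r)"
    by unfold_locales (auto simp: S Z_def k_def)
  have k: "0 < k" by (simp add: k_def)
  have log_Z: "log 2 (card Z) = real k * log 2 (real (card S))"
    using \<open>0 < card S\<close> unfolding Z_def by (subst card_inputs [OF S]) (auto simp: k_def log_nat_power)
  have "log 2 (real (card S)) = real q" using assms(3) by simp
  \<comment> \<open>With a single constellation point the rate would be 0 and outage
    meaningless.\<close>
  then have "0 < log 2 (card Z)" using k \<open>q \<ge> 1\<close> unfolding log_Z by simp
  then have R: "0 < R" "R < log 2 (card Z)"
    unfolding R_def log_Z [symmetric] using assms(5,6) by auto
  define \<mu> where "\<mu> = distr \<Omega> borel (P 1)"
  have haar: "haar_unitary \<mu>" unfolding \<mu>_def by (rule assms(10)) simp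
  \<comment> \<open>Each precoder is Haar distributed by hypothesis; uniqueness gives the common law
    that averaging over time requires.\<close>
  have P_distr: "distr \<Omega> borel (P t) = \<mu>" if "t \<ge> 1" for t
    by (rule haar_unitary_unique [OF assms(10) [OF that] haar])
  interpret mu: prob_space \<mu> by (rule haar_unitaryD [OF haar])
  have s [measurable_cong]: "sets \<mu> = sets borel" by (rule haar_unitaryD [OF haar])
  have H_entry [measurable]: "(\<lambda>\<omega>. H \<omega> $ i $ j) \<in> borel_measurable \<Omega>" for i j
    using assms(7) by (auto simp: indep_vars_def)
  have H [measurable]: "H \<in> borel_measurable \<Omega>"
  proof -
    have "(\<lambda>\<omega>. \<chi> i. \<chi> j. H \<omega> $ i $ j) \<in> borel_measurable \<Omega>" by measurable
    then show ?thesis by simp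
  qed
  define J where "J \<gamma> h = (\<integral>P. channel_information S \<gamma> h P \<partial>\<mu>)" for \<gamma> and h :: "complex^'t::{finite,linorder}^'r"
  note CI = borel_measurable_channel_information
  have [measurable]: "J \<gamma> \<in> borel_measurable borel" for \<gamma>
    unfolding J_def
    using CI [of \<gamma>]
    by (intro mu.borel_measurable_lebesgue_integral)
       (simp add: case_prod_unfold measurable_cong_sets [OF sets_pair_measure_cong [OF refl s] refl])
  have out: "outage_probability \<Omega> H P S R \<gamma> = prob {\<omega> \<in> space \<Omega>. J \<gamma> (H \<omega>) < R}" for \<gamma>
  proof -
    let ?X = "\<lambda>N \<omega>. (\<Sum>t=1..N. channel_information S \<gamma> (H \<omega>) (P t \<omega>)) / real N"
    have X [measurable]: "?X N \<in> borel_measurable \<Omega>" for N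
    proof -
      have "(\<lambda>\<omega>. channel_information S \<gamma> (H \<omega>) (P t \<omega>)) \<in> borel_measurable \<Omega>" if "t \<ge> 1" for t
        using measurable_compose [OF measurable_Pair [OF H assms(9) [OF that]] CI [of \<gamma>]] by simp
      then show ?thesis by (intro borel_measurable_divide borel_measurable_sum) auto
    qed
    \<comment> \<open>Replaces the quantifier over real \<open>L\<close> by the limit operator,
      which makes the outage event measurable.\<close>
    have eq: "(\<exists>L. (\<lambda>N. ?X N \<omega>) \<longlonglongrightarrow> L \<and> L < R) \<longleftrightarrow>
        (\<lambda>N. ?X N \<omega>) \<longlonglongrightarrow> lim (\<lambda>N. ?X N \<omega>) \<and> lim (\<lambda>N. ?X N \<omega>) < R" for \<omega>
      using limI [of "\<lambda>N. ?X N \<omega>"] by blast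
    have "AE \<omega> in \<Omega>. (\<lambda>N. ?X N \<omega>) \<longlonglongrightarrow> J \<gamma> (H \<omega>)"
      using conditional_SLLN [OF H assms(9) P_distr assms(11) CI [of \<gamma>], unfolded fst_conv snd_conv,
          OF _ _ channel_information_bounded]
      by (simp add: J_def)
    then have "AE \<omega> in \<Omega>. (\<exists>L. (\<lambda>N. ?X N \<omega>) \<longlonglongrightarrow> L \<and> L < R) \<longleftrightarrow> J \<gamma> (H \<omega>) < R"
      by eventually_elim (metis LIMSEQ_unique)
    then have "AE \<omega> in \<Omega>. \<omega> \<in> {\<omega> \<in> space \<Omega>. \<exists>L. (\<lambda>N. ?X N \<omega>) \<longlonglongrightarrow> L \<and> L < R} \<longleftrightarrow>
        \<omega> \<in> {\<omega> \<in> space \<Omega>. J \<gamma> (H \<omega>) < R}"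
      by eventually_elim simp
    moreover have [measurable]: "(\<lambda>\<omega>. lim (\<lambda>N. ?X N \<omega>)) \<in> borel_measurable \<Omega>"
      by (rule borel_measurable_lim_metric [OF X])
    have "{\<omega> \<in> space \<Omega>. \<exists>L. (\<lambda>N. ?X N \<omega>) \<longlonglongrightarrow> L \<and> L < R} \<in> events"
      unfolding eq using measurable_limit2 [OF X] by measurable
    moreover have "{\<omega> \<in> space \<Omega>. J \<gamma> (H \<omega>) < R} \<in> events"
      by measurable
    ultimately show ?thesis
      unfolding outage_probability_def by (rule measure_eq_AE)
  qed
  obtain e where e: "0 < e" "\<And>\<gamma> (H :: complex^'t::{finite,linorder}^'r) P. 0 \<le> \<gamma> \<Longrightarrow> unitary P \<Longrightarrow>
      (\<And>i j. sqrt \<gamma> * cmod (H $ i $ j) \<le> e) \<Longrightarrow> channel_information S \<gamma> H P \<le> R / 2"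
    using information_small [of "R / 2"] R(1) by auto
  obtain T where T: "0 < T" "\<And>\<gamma> (H :: complex^'t::{finite,linorder}^'r) i j. 0 \<le> \<gamma> \<Longrightarrow>
      T \<le> sqrt \<gamma> * cmod (H $ i $ j) \<Longrightarrow> R \<le> J \<gamma> H"
    using mean_information_large [OF haar R(2)] unfolding J_def by metis
  obtain c C where cC: "0 < c" "0 < C"
    "\<And>e. 0 < e \<Longrightarrow> e \<le> 1 \<Longrightarrow> c * e\<^sup>2 \<le> measure complex_gaussian (cball 0 e)"
    "\<And>e. 0 < e \<Longrightarrow> measure complex_gaussian (cball 0 e) \<le> C * e\<^sup>2"
    using complex_gaussian_ball by blast
  let ?n = "CARD('t) * CARD('r)"
  let ?G = "\<lambda>u. {\<omega> \<in> space \<Omega>. \<forall>i j. cmod (H \<omega> $ i $ j) \<le> u}"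
  note ball = prob_gaussian_entries [OF assms(7,8)]
  have lower: "(c * e\<^sup>2) ^ ?n / \<gamma> ^ ?n \<le> outage_probability \<Omega> H P S R \<gamma>" if \<gamma>: "max 1 (e\<^sup>2) < \<gamma>" for \<gamma>
  proof -
    \<comment> \<open>The condition e^2 < gamma keeps the radius in the range of the lower Gaussian
      bound.\<close>
    have u: "0 < e / sqrt \<gamma>" "e / sqrt \<gamma> \<le> 1"
      using \<gamma> e(1) real_le_rsqrt [of e \<gamma>] by (auto simp: divide_le_eq)
    have "(c * e\<^sup>2) ^ ?n / \<gamma> ^ ?n = (c * (e / sqrt \<gamma>)\<^sup>2) ^ ?n"
      using \<gamma> by (simp add: power_divide)
    also have "\<dots> \<le> prob (?G (e / sqrt \<gamma>))"
      unfolding ball using cC(1) cC(3) [OF u] by (intro power_mono) auto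
    also have "\<dots> \<le> prob {\<omega> \<in> space \<Omega>. J \<gamma> (H \<omega>) < R}"
    proof (rule finite_measure_mono, safe)
      fix \<omega> assume "\<forall>i j. cmod (H \<omega> $ i $ j) \<le> e / sqrt \<gamma>"
      then have "sqrt \<gamma> * cmod (H \<omega> $ i $ j) \<le> e" for i j
        using \<gamma> by (auto simp: le_divide_eq mult.commute)
      then have small: "AE P in \<mu>. channel_information S \<gamma> (H \<omega>) P \<le> R / 2"
        using haar_unitaryD(3) [OF haar] e(2) [of \<gamma> _ "H \<omega>"] \<gamma> by auto
      have "J \<gamma> (H \<omega>) \<le> (\<integral>P. R / 2 \<partial>\<mu>)"
      \<comment> \<open>In the second case the integral is 0 by convention and the bound is
        immediate.\<close>
      proof (cases "integrable \<mu> (channel_information S \<gamma> (H \<omega>))")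
        case True
        then show ?thesis unfolding J_def using small by (intro integral_mono_AE) auto
      next
        case False
        then show ?thesis using R(1) by (simp add: J_def not_integrable_integral_eq)
      qed
      then show "J \<gamma> (H \<omega>) < R" using R(1) by (simp add: mu.prob_space)
    qed measurable
    finally show ?thesis unfolding out .
  qed
  have upper: "outage_probability \<Omega> H P S R \<gamma> \<le> (C * T\<^sup>2) ^ ?n / \<gamma> ^ ?n" if \<gamma>: "1 < \<gamma>" for \<gamma>
  proof -
    \<comment> \<open>Contrapositive of the choice of \<open>T\<close>: an outage leaves no entry
      above this radius.\<close>
    have "prob {\<omega> \<in> space \<Omega>. J \<gamma> (H \<omega>) < R} \<le> prob (?G (T / sqrt \<gamma>))"
    proof (rule finite_measure_mono, safe)
      fix \<omega> i j assume J: "J \<gamma> (H \<omega>) < R"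
      show "cmod (H \<omega> $ i $ j) \<le> T / sqrt \<gamma>"
      proof (rule ccontr)
        assume "\<not> cmod (H \<omega> $ i $ j) \<le> T / sqrt \<gamma>"
        then have "T \<le> sqrt \<gamma> * cmod (H \<omega> $ i $ j)"
          using \<gamma> by (simp add: divide_less_eq mult.commute not_le)
        then show False using T(2) [of \<gamma> "H \<omega>" i j] \<gamma> J by simp
      qed
    qed measurable
    also have "\<dots> \<le> (C * (T / sqrt \<gamma>)\<^sup>2) ^ ?n"
      unfolding ball using cC(4) [of "T / sqrt \<gamma>"] T(1) \<gamma> by (intro power_mono) auto
    also have "\<dots> = (C * T\<^sup>2) ^ ?n / \<gamma> ^ ?n"
      using \<gamma> by (simp add: power_divide)
    finally show ?thesis unfolding out .
  qed
  have "((\<lambda>\<gamma>. - ln (outage_probability \<Omega> H P S R \<gamma>) / ln \<gamma>) \<longlongrightarrow> real ?n) at_top"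
  proof (rule tendsto_exponent)
    show "0 < (c * e\<^sup>2) ^ ?n" "0 < (C * T\<^sup>2) ^ ?n" using cC e T by simp_all
    show "\<forall>\<^sub>F \<gamma> in at_top. (c * e\<^sup>2) ^ ?n / \<gamma> ^ ?n \<le> outage_probability \<Omega> H P S R \<gamma>"
      using eventually_gt_at_top by (rule eventually_mono) (rule lower)
    show "\<forall>\<^sub>F \<gamma> in at_top. outage_probability \<Omega> H P S R \<gamma> \<le> (C * T\<^sup>2) ^ ?n / \<gamma> ^ ?n"
      using eventually_gt_at_top by (rule eventually_mono) (rule upper)
  qed
  then show ?thesis by (simp only: R_def k_def)
qed

end
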